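(* Let $R>1$ and let $f=\{f_v:\ v\in B(s,R)\}$ be a family of holomorphic functions on the open unit disk $\mathbb{D}_1\subset\mathbb{C}$ depending holomorphically on the parameter $v\in B(s,R)\subset\mathbb{C}^s$. Define $f_0(v):=f_v(0)$, a holomorphic function on $B(s,R)$, and let $d_{f_0}(R)$ be its Chebyshev degree in $B(s,1)$. Let $V\subset B(s,1)\subset\mathbb{C}^s(\cong\mathbb{R}^{2s})$ be a convex set of real dimension $k$. Assume that $$\sup_{v\in V}\sup_{z\in\mathbb{D}_1}|f_v(z)|\le M_1<\infty\qquad\text{and}\qquad \sup_{v\in V}|f_0(v)|\ge M_2>0 .$$ Then for $0<\rho<1$, $$\frac{1}{|V|}\int_V\mathcal{N}_{f,\rho}(v)\,dv\le\frac{d_{f_0}(R)\log(4ek)+\log(M_1/M_2)}{\log(1/\rho)} .$$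
   Context: $B(s,R)$ is the open Euclidean ball of radius $R$ in $\mathbb{C}^s$ centered at $0$, and $\mathbb{D}_t=B(1,t)\subset\mathbb{C}$. That the family depends holomorphically on $v$ means that $(v,z)\mapsto f_v(z)$ is holomorphic on $B(s,R)\times\mathbb{D}_1$. Zero-counting function: $\mathcal{N}_{f,\rho}(v):=\#\{z\in\overline{\mathbb{D}}_\rho:\ f_v(z)=0\}$, with $\mathcal{N}_{f,\rho}(v)=+\infty$ if $f_v\equiv 0$ on $\mathbb{D}_1$. Chebyshev degree: for $R>1$ and a holomorphic function $h$ on $B(s,R)$, the Chebyshev degree $d_h(R)$ of $h$ in $B(s,1)$ is the optimal (smallest) constant $d$ such that for every real interval (straight line segment) $I\subset B(s,1)$, where $\mathbb{C}^s$ is identified with $\mathbb{R}^{2s}$, and every measurable subset $\omega\subset I$ (of positive length), $$\sup_I|h|\le\left(\frac{4|I|}{|\omega|}\right)^{d}\sup_\omega|h| ,$$ where $|\cdot|$ of a subset of $I$ is its one-dimensional Lebesgue measure. It is known that such a finite constant $d>0$ exists. The real dimension of $V$ is the dimension of its real affine hull; $|V|$ and $dv$ refer to Lebesgue measure in the real affine hull of $V$. Here $e$ is the base of the natural logarithm $\log$. *)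

theory Defs
  imports "HOL-Analysis.Analysis"
begin

text \<open>Joint holomorphy in the variables \<open>v\<close> in \<open>\<complex>\<^sup>s\<close> and \<open>z\<close> in \<open>\<complex>\<close>: the Frechet derivative exists at
  every point of the (open) set and is complex linear. \<open>*s\<close> is multiplication by a complex scalar;
  additivity of \<open>D\<close> is part of \<open>has_derivative\<close>.\<close>

definition holomorphic_family_on ::
    "(complex ^ 's \<Rightarrow> complex \<Rightarrow> complex) \<Rightarrow> ((complex ^ 's) \<times> complex) set \<Rightarrow> bool" where
  "holomorphic_family_on f S \<longleftrightarrow>
     (\<forall>p\<in>S. \<exists>D. ((\<lambda>(v, z). f v z) has_derivative D) (at p) \<and>
                (\<forall>c w \<zeta>. D (c *s w, c * \<zeta>) = c * D (w, \<zeta>)))"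

definition zero_count :: "(complex ^ 's \<Rightarrow> complex \<Rightarrow> complex) \<Rightarrow> real \<Rightarrow> complex ^ 's \<Rightarrow> ennreal" where
  "zero_count f \<rho> v =
     (if \<forall>z\<in>ball 0 1. f v z = 0 then \<infinity> else of_nat (card {z \<in> cball 0 \<rho>. f v z = 0}))"

text \<open>A real interval in the unit ball is written as \<open>{p + t u | t \<in> J}\<close> with \<open>\<bar>u\<bar> = 1\<close> and \<open>J\<close> an
  interval of the real line, so that lengths of its subsets are Lebesgue measures of subsets of \<open>J\<close>.
  The suprema are those of \<open>\<bar>h\<bar>\<close>; they are finite for every \<open>h\<close> continuous on the closed unit ball.\<close>

definition chebyshev_exponent :: "(complex ^ 's \<Rightarrow> complex) \<Rightarrow> real \<Rightarrow> bool" where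
  "chebyshev_exponent h d \<longleftrightarrow>
     (\<forall>p u J \<omega>. norm u = 1 \<longrightarrow> is_interval J \<longrightarrow> (\<lambda>t. p + t *\<^sub>R u) ` J \<subseteq> ball 0 1 \<longrightarrow>
        \<omega> \<subseteq> J \<longrightarrow> \<omega> \<in> sets lebesgue \<longrightarrow> 0 < measure lebesgue \<omega> \<longrightarrow>
        (SUP t\<in>J. norm (h (p + t *\<^sub>R u)))
          \<le> (4 * measure lebesgue J / measure lebesgue \<omega>) powr d * (SUP t\<in>\<omega>. norm (h (p + t *\<^sub>R u))))"

text \<open>The condition \<open>0 \<le> d\<close> only matters if \<open>h\<close> vanishes on the unit ball: otherwise it follows by
  taking \<open>\<omega>\<close> to be the whole interval. The radius \<open>R\<close> of the ball on which \<open>h\<close> is holomorphic does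
  not enter the value. The degree is an extended real, equal to \<open>\<infinity>\<close> if there is no admissible
  exponent; this does not occur for \<open>h\<close> holomorphic on a ball of radius larger than 1.\<close>

definition chebyshev_degree :: "(complex ^ 's \<Rightarrow> complex) \<Rightarrow> ereal" where
  "chebyshev_degree h = (INF d\<in>{d. 0 \<le> d \<and> chebyshev_exponent h d}. ereal d)"

definition orthonormal_basis_of_direction :: "'a::euclidean_space set \<Rightarrow> 'a set \<Rightarrow> bool" where
  "orthonormal_basis_of_direction V B \<longleftrightarrow>
     pairwise orthogonal B \<and> (\<forall>b\<in>B. norm b = 1) \<and> span B = span {x - y | x y. x \<in> V \<and> y \<in> V}"

text \<open>Lebesgue measure in the real affine hull of a nonempty set \<open>V\<close>, as a measure on the ambient space:
  the image of the product Lebesgue measure on the coordinates with respect to an orthonormal basis of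
  the direction space. It does not depend on the base point and basis chosen. The completion is needed
  because a convex set need not be Borel.\<close>

definition affine_lebesgue :: "'a::euclidean_space set \<Rightarrow> 'a measure" where
  "affine_lebesgue V =
     (let p = (SOME p. p \<in> V); B = (SOME B. orthonormal_basis_of_direction V B)
      in completion (distr (Pi\<^sub>M B (\<lambda>_. lborel)) borel (\<lambda>x. p + (\<Sum>b\<in>B. x b *\<^sub>R b))))"

end

theory Submission
  imports Defs "HOL-Complex_Analysis.Complex_Analysis"
begin

text \<open>Jensen's inequality, obtained by dividing out Blaschke factors, bounds \<open>N(v) ln (1/\<rho>)\<close> by
  \<open>ln (M1 / \<bar>f\<^sub>0(v)\<bar>)\<close>, so it remains to average \<open>ln (m / \<bar>f\<^sub>0\<bar>)\<close> over \<open>V\<close>, where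
  \<open>m = \<bar>f\<^sub>0(v0)\<bar>\<close> is nearly the maximum. On a segment from \<open>v0\<close> to a point of \<open>V\<close> the Chebyshev
  inequality says that \<open>\<bar>f\<^sub>0\<bar> < m e\<^sup>-\<^sup>s\<close> holds on a proportion of at most \<open>4 e\<^sup>-\<^sup>s\<^sup>/\<^sup>d\<close> of its length. In polar
  coordinates about \<open>v0\<close> the radial density is \<open>k t\<^sup>k\<^sup>-\<^sup>1 \<le> k\<close>, and integrating \<open>min 1 (4 k e\<^sup>-\<^sup>s\<^sup>/\<^sup>d)\<close> over
  \<open>s \<ge> 0\<close> gives \<open>d ln (4 e k)\<close>. Polar coordinates are replaced by averaging over the homotheties about
  \<open>v0\<close> a thin shell at the boundary of \<open>V\<close>.\<close>

subsection \<open>Zeros of bounded holomorphic functions on the disc\<close>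

text \<open>Composing \<open>g\<close> with the disc automorphism that takes 0 to \<open>a\<close>
  gives a function vanishing at 0. Schwarz's lemma then bounds \<open>g\<close> by \<open>M\<close>
  times the modulus of the Blaschke factor, so the quotient keeps the bound \<open>M\<close>. This
  avoids boundary values on the unit circle.\<close>

lemma divide_Blaschke_factor:
  fixes g :: "complex \<Rightarrow> complex"
  assumes hol: "g holomorphic_on ball 0 1" and bound: "\<And>z. norm z < 1 \<Longrightarrow> norm (g z) \<le> M"
    and a: "norm a < 1" "g a = 0"
  obtains F where "F holomorphic_on ball 0 1" "\<And>z. norm z < 1 \<Longrightarrow> norm (F z) \<le> M"
    "\<And>z. norm z < 1 \<Longrightarrow> g z = Moebius_function 0 a z * F z"
proof -
  \<comment> \<open>Away from \<open>a\<close> this is \<open>g\<close> divided by the Blaschke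
    factor; as \<open>g a = 0\<close>, the value \<open>deriv g a\<close> removes the
    singularity.\<close>
  define F where "F z = (if z = a then deriv g a else (g z - g a) / (z - a)) * (1 - cnj a * z)" for z
  have holF: "F holomorphic_on ball 0 1"
    unfolding F_def by (intro holomorphic_intros pole_lemma_open hol open_ball)
  have nz: "1 - cnj a * z \<noteq> 0" if "norm z < 1" for z
  proof -
    have "norm (cnj a * z) < 1"
      using norm_mult_less[of "cnj a" 1 z 1] a that by simp
    then show ?thesis by force
  qed
  have fac: "g z = Moebius_function 0 a z * F z" if "norm z < 1" for z
    using nz[OF that] a by (auto simp: F_def Moebius_function_simple)
  \<comment> \<open>The slack \<open>e\<close> makes \<open>G\<close> strictly smaller than 1 in
    modulus, as Schwarz's lemma requires, and keeps the denominator positive when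
    \<open>M = 0\<close>.\<close>
  have bd: "norm (F z) \<le> M + e" if z: "norm z < 1" "z \<noteq> a" and e: "0 < e" for z e
  proof -
    let ?m = "Moebius_function 0 a z"
    have M: "0 \<le> M" using order_trans[OF norm_ge_zero bound[of 0]] by simp
    define G where "G w = g (Moebius_function 0 (-a) w) / of_real (M + e)" for w
    have im: "norm (Moebius_function 0 (-a) w) < 1" if "norm w < 1" for w
      using Moebius_function_norm_lt_1 a that by simp
    have holG: "G holomorphic_on ball 0 1"
    proof -
      have "(g \<circ> Moebius_function 0 (-a)) holomorphic_on ball 0 1"
        by (rule holomorphic_on_compose_gen[OF Moebius_function_holomorphic hol]) (use a im in auto)
      then show ?thesis
        unfolding G_def o_def using M e by (intro holomorphic_intros) (auto simp flip: of_real_add)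
    qed
    have G0: "G 0 = 0"
      using a by (simp add: G_def Moebius_function_of_zero)
    have G1: "norm (G w) < 1" if "norm w < 1" for w
    proof -
      have "norm (g (Moebius_function 0 (-a) w)) \<le> M" using bound im[OF that] by blast
      then show ?thesis using M e by (simp add: G_def norm_divide flip: of_real_add)
    qed
    have m1: "norm ?m < 1" using Moebius_function_norm_lt_1 a z by simp
    have m0: "?m \<noteq> 0" using z nz[of z] by (simp add: Moebius_function_simple)
    have inv: "Moebius_function 0 (-a) ?m = z"
      by (rule Moebius_function_compose) (use a z in auto)
    have "norm (G ?m) \<le> norm ?m"
      using Schwarz_Lemma(1)[OF holG G0 G1 m1] .
    then have "norm (g z) \<le> (M + e) * norm ?m"
      using M e by (simp add: G_def inv norm_divide field_simps flip: of_real_add)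
    then have "norm ?m * norm (F z) \<le> norm ?m * (M + e)"
      unfolding fac[OF z(1)] by (simp add: norm_mult mult.commute)
    then show ?thesis using m0 by (metis mult_le_cancel_left_pos zero_less_norm_iff)
  qed
  have bd': "norm (F z) \<le> M" if "norm z < 1" "z \<noteq> a" for z
    using bd[OF that] by (rule field_le_epsilon)
  \<comment> \<open>At \<open>a\<close> the Blaschke factor vanishes and cannot be cancelled; the
    bound there is a limit of the bounds nearby.\<close>
  have "norm (F a) \<le> M"
  proof (rule tendsto_upperbound)
    have "isCont F a"
      using holF a holomorphic_on_imp_continuous_on continuous_on_eq_continuous_at[of "ball 0 1" F]
      by auto
    then show "((\<lambda>z. norm (F z)) \<longlongrightarrow> norm (F a)) (at a)"
      by (intro tendsto_norm) (simp add: isCont_def)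
    have "\<forall>\<^sub>F z in at a. z \<in> ball 0 1 - {a}"
      using a by (intro eventually_at_in_open) auto
    then show "\<forall>\<^sub>F z in at a. norm (F z) \<le> M"
      by eventually_elim (use bd' in auto)
  qed simp
  with bd' holF fac that show ?thesis by metis
qed

text \<open>Zeros are divided out one at a time. Each division preserves the bound \<open>M\<close>
  and the remaining zeros, and costs a factor of modulus \<open>norm a\<close>, at most
  \<open>\<rho>\<close>, at the origin. Distinct zeros are counted, in agreement with
  \<open>zero_count\<close>.\<close>

lemma norm_at_0_le_power_card_zeros:
  fixes g :: "complex \<Rightarrow> complex"
  assumes "finite Z" "g holomorphic_on ball 0 1" "\<And>z. norm z < 1 \<Longrightarrow> norm (g z) \<le> M"
    and "\<And>z. z \<in> Z \<Longrightarrow> g z = 0" "Z \<subseteq> cball 0 \<rho>" "0 \<le> \<rho>" "\<rho> < 1"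
  shows "norm (g 0) \<le> \<rho> ^ card Z * M"
  using assms(1-5)
proof (induction Z arbitrary: g rule: finite_induct)
  case empty
  then show ?case by simp
next
  case (insert a Z)
  from insert.prems have a: "norm a \<le> \<rho>" "g a = 0" by auto
  with \<open>\<rho> < 1\<close> have a1: "norm a < 1" by simp
  from divide_Blaschke_factor[OF insert.prems(1,2) a1 a(2)] obtain F where
    F: "F holomorphic_on ball 0 1" "\<And>z. norm z < 1 \<Longrightarrow> norm (F z) \<le> M"
      "\<And>z. norm z < 1 \<Longrightarrow> g z = Moebius_function 0 a z * F z" by blast
  have zero: "F z = 0" if "z \<in> Z" for z
  proof -
    have z: "z \<noteq> a" "norm z < 1" "g z = 0"
      using that insert.hyps insert.prems \<open>\<rho> < 1\<close> by force+
    have "norm (cnj a * z) < 1"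
      using norm_mult_less[of "cnj a" 1 z 1] a1 z by simp
    then have "1 - cnj a * z \<noteq> 0" by force
    then have "Moebius_function 0 a z \<noteq> 0"
      using z by (simp add: Moebius_function_simple)
    then show ?thesis using F(3)[OF z(2)] z by simp
  qed
  have "norm (F 0) \<le> \<rho> ^ card Z * M"
    by (rule insert.IH[OF F(1) F(2) zero]) (use insert.prems in auto)
  moreover have "norm (g 0) = norm a * norm (F 0)"
    using F(3)[of 0] by (simp add: Moebius_function_of_zero norm_mult)
  ultimately have "norm (g 0) \<le> \<rho> * (\<rho> ^ card Z * M)"
    using a \<open>0 \<le> \<rho>\<close> by (simp add: mult_mono)
  then show ?case using insert.hyps by (simp add: mult.assoc)
qed

corollary card_zeros_mult_ln_le:
  fixes g :: "complex \<Rightarrow> complex"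
  assumes hol: "g holomorphic_on ball 0 1" and bound: "\<And>z. norm z < 1 \<Longrightarrow> norm (g z) \<le> M"
    and nz: "g 0 \<noteq> 0" and \<rho>: "0 < \<rho>" "\<rho> < 1"
  shows "real (card {z \<in> cball 0 \<rho>. g z = 0}) * ln (1 / \<rho>) \<le> ln (M / norm (g 0))"
proof -
  let ?Z = "{z \<in> cball 0 \<rho>. g z = 0}"
  have M: "norm (g 0) \<le> M" "0 < norm (g 0)" using bound[of 0] nz by auto
  have "norm (g 0) \<le> \<rho> ^ card ?Z * M"
  \<comment> \<open>For infinite \<open>?Z\<close> the convention \<open>card ?Z = 0\<close> reduces
    the claim to \<open>norm (g 0) \<le> M\<close>.\<close>
  proof (cases "finite ?Z")
    case True
    then show ?thesis
      by (intro norm_at_0_le_power_card_zeros hol) (use bound \<rho> in auto)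
  qed (use M in simp)
  then have "(1 / \<rho>) ^ card ?Z \<le> M / norm (g 0)"
    using M \<rho> by (simp add: power_one_over field_simps)
  then have "ln ((1 / \<rho>) ^ card ?Z) \<le> ln (M / norm (g 0))"
    using M \<rho> by (intro ln_mono) auto
  then show ?thesis using \<rho> by (simp add: ln_realpow)
qed

subsection \<open>Averages over homotheties\<close>

text \<open>Layer-cake integration of the smaller of 1 and \<open>c * exp (- s / d)\<close>. The two
  bounds cross at \<open>s0 = d * ln c\<close>: the constant 1 contributes \<open>s0\<close> before
  it and the exponential contributes \<open>d\<close> after it.\<close>

lemma nn_integral_le_of_exponential_tail:
  fixes u :: "'a \<Rightarrow> ennreal"
  assumes mass: "emeasure N (space N) \<le> 1"
    and u [measurable]: "u \<in> borel_measurable N"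
    and d: "0 < d" and c: "1 \<le> c"
    and tail: "\<And>s. 0 \<le> s \<Longrightarrow> emeasure N {x\<in>space N. ennreal s < u x} \<le> ennreal (c * exp (- s / d))"
  shows "(\<integral>\<^sup>+x. u x \<partial>N) \<le> ennreal (d * ln c + d)"
proof -
  have "emeasure N (space N) \<noteq> \<infinity>" using mass by (auto simp: top_unique)
  then interpret finite_measure N by (rule finite_measureI)
  interpret pair_sigma_finite lborel N ..
  define s0 where "s0 = d * ln c"
  have s0: "0 \<le> s0" using c d by (simp add: s0_def)
  let ?I = "\<lambda>x s. indicator {s. 0 \<le> s \<and> ennreal s < u x} s :: ennreal"
  \<comment> \<open>The value of \<open>u\<close> is the length of the interval of levels below it;
    for the value infinity this is a half-line.\<close>
  have layer: "u x = (\<integral>\<^sup>+s. ?I x s \<partial>lborel)" for x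
  proof (cases "u x")
    case (real r)
    then have "{s. 0 \<le> s \<and> ennreal s < u x} = {0..<r}"
      by (auto simp: ennreal_less_iff)
    then show ?thesis using real by simp
  next
    case top
    then have "{s. 0 \<le> s \<and> ennreal s < u x} = {0..}" by auto
    moreover have "emeasure lborel {0::real..} = top"
    proof (rule ccontr)
      assume "emeasure lborel {0::real..} \<noteq> top"
      then obtain n :: nat where n: "emeasure lborel {0::real..} < of_nat n"
        using ennreal_Ex_less_of_nat by (auto simp: less_top)
      have "emeasure lborel {0..real n} \<le> emeasure lborel {0::real..}"
        by (intro emeasure_mono) auto
      with n show False by (simp add: ennreal_of_nat_eq_real_of_nat)
    qed
    ultimately show ?thesis using top by simp
  qed
  have "(\<integral>\<^sup>+x. u x \<partial>N) = (\<integral>\<^sup>+x. \<integral>\<^sup>+s. ?I x s \<partial>lborel \<partial>N)"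
    by (subst layer) simp
  also have "\<dots> = (\<integral>\<^sup>+s. \<integral>\<^sup>+x. ?I x s \<partial>N \<partial>lborel)"
  proof (rule Fubini')
    show "(\<lambda>(s, x). ?I x s) \<in> borel_measurable (lborel \<Otimes>\<^sub>M N)"
      unfolding indicator_def by measurable
  qed
  also have "\<dots> \<le> (\<integral>\<^sup>+s. indicator {0..s0} s + ennreal (c * exp (- s / d)) * indicator {s0..} s \<partial>lborel)"
  proof (rule nn_integral_mono)
    fix s :: real
    have eq: "(\<integral>\<^sup>+x. ?I x s \<partial>N) = emeasure N {x\<in>space N. ennreal s < u x}" if "0 \<le> s"
    proof -
      have "(\<integral>\<^sup>+x. ?I x s \<partial>N) = (\<integral>\<^sup>+x. indicator {x\<in>space N. ennreal s < u x} x \<partial>N)"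
        using that by (intro nn_integral_cong) (auto simp: indicator_def)
      then show ?thesis by simp
    qed
    consider "s < 0" | "0 \<le> s" "s \<le> s0" | "s0 < s" by linarith
    then show "(\<integral>\<^sup>+x. ?I x s \<partial>N) \<le> indicator {0..s0} s + ennreal (c * exp (- s / d)) * indicator {s0..} s"
    proof cases
      case 2
      have "(\<integral>\<^sup>+x. ?I x s \<partial>N) \<le> emeasure N (space N)"
        unfolding eq[OF 2(1)] by (rule emeasure_space)
      then have "(\<integral>\<^sup>+x. ?I x s \<partial>N) \<le> 1" using mass by (rule order_trans)
      moreover have "indicator {0..s0} s = (1::ennreal)" using 2 by simp
      ultimately show ?thesis by (simp only: add_increasing2 zero_le)
    next
      case 3
      then show ?thesis using eq tail[of s] s0 by simp
    qed simp
  qed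
  also have "\<dots> = ennreal s0 + (\<integral>\<^sup>+s. ennreal (c * exp (- s / d)) * indicator {s0..} s \<partial>lborel)"
    using s0 by (subst nn_integral_add) simp_all
  also have "(\<integral>\<^sup>+s. ennreal (c * exp (- s / d)) * indicator {s0..} s \<partial>lborel)
      = ennreal (0 - (- (d * c * exp (- s0 / d))))"
  proof (rule nn_integral_FTC_atLeast)
    have "filterlim (\<lambda>s. - s / d) at_bot at_top"
      using filterlim_tendsto_neg_mult_at_bot[OF tendsto_const, of "- 1 / d" "\<lambda>s. s" at_top] d
      by (simp add: filterlim_ident)
    then have "((\<lambda>s. exp (- s / d)) \<longlongrightarrow> 0) at_top"
      by (rule filterlim_compose[OF exp_at_bot])
    then show "((\<lambda>s. - (d * c * exp (- s / d))) \<longlongrightarrow> 0) at_top"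
      using tendsto_mult_left[of _ 0 at_top "- (d * c)"] by fastforce
  qed (use d c in \<open>auto intro!: derivative_eq_intros\<close>)
  also have "exp (- s0 / d) = inverse c"
    using c d by (simp add: s0_def exp_minus)
  finally have "(\<integral>\<^sup>+x. u x \<partial>N) \<le> ennreal s0 + ennreal (0 - - (d * c * inverse c))" .
  moreover have "d * c * inverse c = d" using c by simp
  ultimately show ?thesis
    using c d s0 by (simp add: s0_def flip: ennreal_plus)
qed

section \<open>Scaling of Lebesgue measure and integration along rays\<close>

lemma nn_integral_PiM_lborel_homothety:
  fixes g :: "('i \<Rightarrow> real) \<Rightarrow> ennreal"
  assumes B: "finite B" and t: "0 < t" and g [measurable]: "g \<in> borel_measurable (Pi\<^sub>M B (\<lambda>_. lborel))"
  shows "(\<integral>\<^sup>+x. g x \<partial>Pi\<^sub>M B (\<lambda>_. lborel))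
    = ennreal (t ^ card B) * (\<integral>\<^sup>+x. g (\<lambda>b\<in>B. c b + t * x b) \<partial>Pi\<^sub>M B (\<lambda>_. lborel))"
proof -
  interpret product_sigma_finite "\<lambda>_::'i. lborel :: real measure" ..
  let ?P = "Pi\<^sub>M B (\<lambda>_. lborel :: real measure)"
  \<comment> \<open>The restricted lambda keeps the image in the extensional functions on
    \<open>B\<close>, the space of the product measure.\<close>
  define T where "T x = (\<lambda>b\<in>B. c b + t * x b)" for x :: "'i \<Rightarrow> real"
  have T [measurable]: "T \<in> measurable ?P ?P" unfolding T_def by measurable
  \<comment> \<open>A product measure is determined by its values on boxes, where the scaling factor
    splits into one \<open>t\<close> per coordinate.\<close>
  have "density (distr ?P ?P T) (\<lambda>_. ennreal (t ^ card B)) = ?P"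
  proof (rule PiM_eqI[OF B])
    fix A :: "'i \<Rightarrow> real set" assume A: "\<And>i. i \<in> B \<Longrightarrow> A i \<in> sets lborel"
    have pre: "T -` Pi\<^sub>E B A \<inter> space ?P = Pi\<^sub>E B (\<lambda>b. (\<lambda>y. c b + t * y) -` A b)"
      by (auto simp: T_def space_PiM PiE_iff)
    have mA: "Pi\<^sub>E B A \<in> sets ?P" using A B by (intro sets_PiM_I_finite) auto
    have m1: "(\<lambda>y. c b + t * y) -` A b \<in> sets lborel" if "b \<in> B" for b
      using measurable_sets[of "\<lambda>y. c b + t * y" lborel lborel "A b"] A[OF that] by simp
    have one: "ennreal t * emeasure lborel ((\<lambda>y. c b + t * y) -` A b) = emeasure lborel (A b)" if "b \<in> B" for b
    proof -
      have "emeasure lborel (A b) = (\<integral>\<^sup>+x. indicator (A b) x \<partial>lborel)"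
        using A[OF that] by simp
      also have "\<dots> = ennreal \<bar>t\<bar> * (\<integral>\<^sup>+x. indicator (A b) (c b + t * x) \<partial>lborel)"
        using A[OF that] t by (intro nn_integral_real_affine) auto
      also have "(\<integral>\<^sup>+x. indicator (A b) (c b + t * x) \<partial>lborel)
          = (\<integral>\<^sup>+x. indicator ((\<lambda>y. c b + t * y) -` A b) x \<partial>lborel)"
        by (simp add: indicator_def)
      finally show ?thesis using t m1[OF that] by simp
    qed
    have "emeasure (density (distr ?P ?P T) (\<lambda>_. ennreal (t ^ card B))) (Pi\<^sub>E B A)
        = ennreal (t ^ card B) * emeasure ?P (Pi\<^sub>E B (\<lambda>b. (\<lambda>y. c b + t * y) -` A b))"
      using mA by (simp add: emeasure_density nn_integral_cmult_indicator emeasure_distr pre)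
    also have "\<dots> = (\<Prod>b\<in>B. ennreal t) * (\<Prod>b\<in>B. emeasure lborel ((\<lambda>y. c b + t * y) -` A b))"
      using B m1 t by (subst emeasure_PiM) (auto simp: ennreal_power)
    also have "\<dots> = (\<Prod>b\<in>B. emeasure lborel (A b))"
      unfolding prod.distrib[symmetric] using one by (intro prod.cong) auto
    finally show "emeasure (density (distr ?P ?P T) (\<lambda>_. ennreal (t ^ card B))) (Pi\<^sub>E B A)
        = (\<Prod>i\<in>B. emeasure lborel (A i))" .
  qed simp
  then have "(\<integral>\<^sup>+x. g x \<partial>?P) = (\<integral>\<^sup>+x. g x \<partial>density (distr ?P ?P T) (\<lambda>_. ennreal (t ^ card B)))"
    by simp
  also have "\<dots> = ennreal (t ^ card B) * (\<integral>\<^sup>+x. g (T x) \<partial>?P)"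
    by (simp add: nn_integral_density nn_integral_cmult nn_integral_distr)
  finally show ?thesis by (simp add: T_def)
qed

text \<open>The measure dt/t is invariant under dilations, hence the value does not depend on
  \<open>p\<close> and points at different gauges receive equal weight.\<close>

lemma nn_integral_inverse_shell:
  fixes \<delta> p k :: real
  assumes "0 < p" "0 < \<delta>" "\<delta> < 1" "0 \<le> k"
  shows "(\<integral>\<^sup>+t. ennreal (k / t) * indicator {p..p / \<delta>} t \<partial>lborel) = ennreal (k * ln (1 / \<delta>))"
proof -
  have "p \<le> p / \<delta>" using assms by (simp add: field_simps)
  then have "(\<integral>\<^sup>+t. ennreal (k / t) * indicator {p..p / \<delta>} t \<partial>lborel)
      = ennreal (k * ln (p / \<delta>) - k * ln p)"
    by (intro nn_integral_FTC_Icc[where F = "\<lambda>t. k * ln t"])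
      (use assms in \<open>auto intro!: derivative_eq_intros\<close>)
  also have "k * ln (p / \<delta>) - k * ln p = k * ln (1 / \<delta>)"
    using assms by (simp add: ln_div algebra_simps)
  finally show ?thesis .
qed

text \<open>With \<open>C\<^sub>\<delta> = v0 + \<delta> (C - v0)\<close> and \<open>A = C - C\<^sub>\<delta>\<close>, the rays from \<open>v0\<close> to points of \<open>A\<close> are averaged.
  Substituting \<open>x = v0 + t (v - v0)\<close>, a point \<open>x\<close> of \<open>C\<^sub>\<delta>\<close> with gauge \<open>p\<close> gets the weight \<open>k/t\<close> integrated over
  \<open>p < t < p/\<delta>\<close>, which is \<open>k ln (1/\<delta>)\<close> whatever \<open>p\<close> is, while the mass of \<open>A\<close> is
  \<open>(1 - \<delta>\<^sup>k) \<bar>C\<bar> \<le> k ln (1/\<delta>) \<bar>C\<bar>\<close>.\<close>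

lemma radial_average_shell:
  fixes N :: "'a::euclidean_space measure" and G :: "'a \<Rightarrow> ennreal"
  assumes N: "sigma_finite_measure N" and setsN [measurable_cong]: "sets N = sets borel"
    and hom: "\<And>t g. 0 < t \<Longrightarrow> g \<in> borel_measurable borel \<Longrightarrow>
      (\<integral>\<^sup>+v. g v \<partial>N) = ennreal (t ^ k) * (\<integral>\<^sup>+v. g (v0 + t *\<^sub>R (v - v0)) \<partial>N)"
    and k: "1 \<le> k" and C: "convex C" "bounded C" "v0 \<in> C" "emeasure N C < \<infinity>"
    and mC [measurable]: "C \<in> sets borel" and mG [measurable]: "G \<in> borel_measurable borel"
    and G0: "G v0 = 0"
    and line: "\<And>v. v \<in> C \<Longrightarrow> v \<noteq> v0 \<Longrightarrow>
      (\<integral>\<^sup>+t. G (v0 + t *\<^sub>R (v - v0)) * ennreal (real k * t ^ (k - 1)) * indicator {0<..<1} t \<partial>lborel) \<le> ennreal K"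
    and \<delta>: "0 < \<delta>" "\<delta> < 1"
  shows "(\<integral>\<^sup>+x. G x * indicator C (v0 + (1 / \<delta>) *\<^sub>R (x - v0)) \<partial>N) \<le> ennreal K * emeasure N C"
proof -
  interpret sigma_finite_measure N by fact
  interpret pair_sigma_finite lborel N ..
  have spN [simp]: "space N = UNIV" using sets_eq_imp_space_eq[OF setsN] by simp
  define T where "T t v = v0 + t *\<^sub>R (v - v0)" for t v
  have [measurable]: "(\<lambda>(t, v). T t v) \<in> borel_measurable (borel \<Otimes>\<^sub>M borel)"
    unfolding T_def by measurable
  have [measurable]: "T t \<in> borel_measurable borel" for t unfolding T_def by measurable
  have TT: "T s (T t v) = T (s * t) v" for s t v by (simp add: T_def algebra_simps)
  have T1 [simp]: "T 1 v = v" for v by (simp add: T_def)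
  have star: "T t x \<in> C" if "x \<in> C" "0 \<le> t" "t \<le> 1" for t x
  proof -
    have "T t x = (1 - t) *\<^sub>R v0 + t *\<^sub>R x" by (simp add: T_def algebra_simps)
    then show ?thesis using convexD[OF C(1,3) that(1), of "1 - t" t] that by simp
  qed
  define A where "A = {x \<in> C. T (1 / \<delta>) x \<notin> C}"
  have A [measurable]: "A \<in> sets borel" unfolding A_def by measurable
  have v0A: "v0 \<notin> A" using C(3) by (simp add: A_def T_def)
  let ?w = "\<lambda>t::real. ennreal (real k * t ^ (k - 1)) * indicator {0<..<1} t :: ennreal"
  let ?I = "\<integral>\<^sup>+x. G x * indicator C (T (1 / \<delta>) x) \<partial>N"
  \<comment> \<open>\<open>C\<close> is the disjoint union of \<open>A\<close> and the homothetic
    copy of ratio \<open>\<delta>\<close>, which has \<open>\<delta> ^ k\<close> times the mass.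
    Finiteness of the masses allows the subtraction in the reals.\<close>
  have mass: "emeasure N A = ennreal (1 - \<delta> ^ k) * emeasure N C"
  proof -
    have "(\<integral>\<^sup>+v. indicator C (T (1 / \<delta>) v) \<partial>N)
        = ennreal (\<delta> ^ k) * (\<integral>\<^sup>+v. indicator C (T (1 / \<delta>) (T \<delta> v)) \<partial>N)"
      unfolding T_def[of \<delta>] by (rule hom) (use \<delta> in auto)
    then have s: "(\<integral>\<^sup>+v. indicator C (T (1 / \<delta>) v) \<partial>N) = ennreal (\<delta> ^ k) * emeasure N C"
      using \<delta> by (simp add: TT)
    have "emeasure N C = (\<integral>\<^sup>+v. indicator A v + indicator C (T (1 / \<delta>) v) \<partial>N)"
    proof -
      have "indicator C v = indicator A v + (indicator C (T (1 / \<delta>) v) :: ennreal)" for v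
        using star[of "T (1 / \<delta>) v" \<delta>] \<delta> by (auto simp: A_def indicator_def TT)
      then show ?thesis by (metis (no_types, lifting) nn_integral_cong nn_integral_indicator mC setsN)
    qed
    also have "\<dots> = emeasure N A + ennreal (\<delta> ^ k) * emeasure N C"
      by (subst nn_integral_add) (simp_all add: s)
    finally have e: "emeasure N C = emeasure N A + ennreal (\<delta> ^ k) * emeasure N C" .
    obtain c where c: "emeasure N C = ennreal c" "0 \<le> c" using C(4) by (cases "emeasure N C") auto
    have "emeasure N A \<le> emeasure N C" by (rule emeasure_mono) (auto simp: A_def)
    then obtain a where a: "emeasure N A = ennreal a" "0 \<le> a"
      using C(4) by (cases "emeasure N A") (auto simp: top_unique)
    have "c = a + \<delta> ^ k * c"
      using e \<delta> a(2) c(2) unfolding a(1) c(1)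
      by (simp add: ennreal_mult[symmetric] ennreal_plus[symmetric] del: ennreal_plus)
    then have "a = (1 - \<delta> ^ k) * c" by (simp add: algebra_simps)
    then show ?thesis
      using a c \<delta> by (simp add: ennreal_mult[symmetric] power_le_one)
  qed
  have "?I * ennreal (real k * ln (1 / \<delta>))
      = (\<integral>\<^sup>+x. G x * indicator C (T (1 / \<delta>) x) * ennreal (real k * ln (1 / \<delta>)) \<partial>N)"
    by (rule nn_integral_multc[symmetric]) measurable
  also have "\<dots> \<le> (\<integral>\<^sup>+x. \<integral>\<^sup>+t. G x * indicator A (T (1 / t) x) * ennreal (real k / t) * indicator {0<..<1} t \<partial>lborel \<partial>N)"
  proof (rule nn_integral_mono)
    fix x
    let ?R = "\<integral>\<^sup>+t. G x * indicator A (T (1 / t) x) * ennreal (real k / t) * indicator {0<..<1} t \<partial>lborel"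
    show "G x * indicator C (T (1 / \<delta>) x) * ennreal (real k * ln (1 / \<delta>)) \<le> ?R"
    \<comment> \<open>The centre has gauge 0 and lies on no shell; there \<open>G0\<close> makes the
      left side vanish.\<close>
    proof (cases "x = v0 \<or> T (1 / \<delta>) x \<notin> C")
      case True
      then show ?thesis using G0 by auto
    next
      case False
      define E where "E = {t. 0 < t \<and> T (1 / t) x \<in> C}"
      \<comment> \<open>The gauge of \<open>x\<close> with respect to \<open>C\<close> and centre
        \<open>v0\<close>. It is positive because \<open>C\<close> is bounded, and at most
        \<open>\<delta>\<close> because \<open>x\<close> lies in the shrunken copy of
        \<open>C\<close>.\<close>
      define p where "p = Inf E"
      have \<delta>E: "\<delta> \<in> E" using False \<delta> by (simp add: E_def)
      obtain r where r: "0 < r" "\<And>y. y \<in> C \<Longrightarrow> norm (y - v0) \<le> r"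
      proof -
        obtain b where "\<And>y. y \<in> C \<Longrightarrow> norm y \<le> b"
          using C(2) unfolding bounded_iff by blast
        then have "norm (y - v0) \<le> b + norm v0" if "y \<in> C" for y
          using norm_triangle_ineq4[of y v0] that by fastforce
        then show ?thesis by (intro that[of "max 1 (b + norm v0)"]) (auto intro: le_max_iff_disj[THEN iffD2])
      qed
      have lower: "norm (x - v0) / r \<le> t" if "t \<in> E" for t
      proof -
        have "norm (T (1 / t) x - v0) \<le> r" using r that by (simp add: E_def)
        then have "norm (x - v0) / t \<le> r" using that by (simp add: E_def T_def)
        then show ?thesis using that r(1) by (simp add: E_def field_simps)
      qed
      then have bdd: "bdd_below E" by (meson bdd_belowI)
      have "norm (x - v0) / r \<le> p"
        unfolding p_def using \<delta>E lower by (intro cInf_greatest) auto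
      moreover have "0 < norm (x - v0) / r" using False r by simp
      ultimately have p: "0 < p" by linarith
      have p\<delta>: "p \<le> \<delta>" unfolding p_def using \<delta>E bdd by (rule cInf_lower)
      have inC: "T (1 / t) x \<in> C" if t: "p < t" for t
      proof -
        obtain s where s: "s \<in> E" "s < t"
          using cInf_lessD[of E t] \<delta>E t unfolding p_def by blast
        then have "T (s / t) (T (1 / s) x) \<in> C"
          by - (rule star, auto simp: E_def)
        then show ?thesis using s by (simp add: TT E_def)
      qed
      have notC: "T (1 / t) x \<notin> C" if "0 < t" "t < p" for t
        using cInf_lower[OF _ bdd, of t] that by (auto simp: p_def E_def)
      have inA: "T (1 / t) x \<in> A" if "p < t" "t < p / \<delta>" for t
      proof -
        have "T (1 / \<delta>) (T (1 / t) x) = T (1 / (\<delta> * t)) x" by (simp add: TT)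
        moreover have "T (1 / (\<delta> * t)) x \<notin> C"
          by (rule notC) (use that p \<delta> in \<open>auto simp: field_simps\<close>)
        ultimately show ?thesis using inC[OF that(1)] by (simp add: A_def)
      qed
      have "G x * indicator C (T (1 / \<delta>) x) * ennreal (real k * ln (1 / \<delta>))
          = G x * (\<integral>\<^sup>+t. ennreal (real k / t) * indicator {p..p / \<delta>} t \<partial>lborel)"
        using False p \<delta> by (subst nn_integral_inverse_shell) simp_all
      also have "\<dots> = (\<integral>\<^sup>+t. G x * (ennreal (real k / t) * indicator {p..p / \<delta>} t) \<partial>lborel)"
        by (rule nn_integral_cmult[symmetric]) measurable
      also have "\<dots> \<le> ?R"
      proof (rule nn_integral_mono_AE)
        \<comment> \<open>At the two end values of \<open>t\<close> the rescaled point may fall on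
          either side of the boundary; they form a null set.\<close>
        have "AE t in lborel. t \<noteq> p \<and> t \<noteq> p / \<delta>"
          using AE_lborel_singleton[of p] AE_lborel_singleton[of "p / \<delta>"] by eventually_elim simp
        then show "AE t in lborel. G x * (ennreal (real k / t) * indicator {p..p / \<delta>} t)
            \<le> G x * indicator A (T (1 / t) x) * ennreal (real k / t) * indicator {0<..<1} t"
        proof eventually_elim
          case (elim t)
          show ?case
          proof (cases "p < t \<and> t < p / \<delta>")
            case True
            \<comment> \<open>Here membership in the shrunken copy is used: the whole window of
              \<open>t\<close> fits into the range of integration along the ray.\<close>
            moreover have "p / \<delta> \<le> 1" using p\<delta> \<delta> by simp
            ultimately have "0 < t" "t < 1" using p by linarith+
            then show ?thesis using True inA[of t] by simp
          qed (use elim in \<open>auto simp: indicator_def\<close>)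
        qed
      qed
      finally show ?thesis .
    qed
  qed
  also have "\<dots> = (\<integral>\<^sup>+t. \<integral>\<^sup>+x. G x * indicator A (T (1 / t) x) * ennreal (real k / t) * indicator {0<..<1} t \<partial>N \<partial>lborel)"
    by (rule Fubini') measurable
  also have "\<dots> = (\<integral>\<^sup>+t. \<integral>\<^sup>+v. indicator A v * (G (T t v) * ?w t) \<partial>N \<partial>lborel)"
  proof (rule nn_integral_cong)
    fix t :: real
    show "(\<integral>\<^sup>+x. G x * indicator A (T (1 / t) x) * ennreal (real k / t) * indicator {0<..<1} t \<partial>N)
        = (\<integral>\<^sup>+v. indicator A v * (G (T t v) * ?w t) \<partial>N)"
    proof (cases "0 < t \<and> t < 1")
      case True
      then have t: "0 < t" "t < 1" by auto
      have "(\<integral>\<^sup>+x. G x * indicator A (T (1 / t) x) * ennreal (real k / t) * indicator {0<..<1} t \<partial>N)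
          = ennreal (t ^ k) * (\<integral>\<^sup>+v. G (T t v) * indicator A (T (1 / t) (T t v)) * ennreal (real k / t) * indicator {0<..<1} t \<partial>N)"
        unfolding T_def[of t] by (rule hom) (use t in auto)
      also have "\<dots> = (\<integral>\<^sup>+v. ennreal (t ^ k) * (G (T t v) * indicator A v * ennreal (real k / t)) \<partial>N)"
        using t by (subst nn_integral_cmult) (auto simp: TT)
      also have "\<dots> = (\<integral>\<^sup>+v. indicator A v * (G (T t v) * ?w t) \<partial>N)"
      proof (rule nn_integral_cong)
        fix v
        \<comment> \<open>The Jacobian \<open>t ^ k\<close> of the homothety turns the
          scale-invariant weight into the radial density of dimension \<open>k\<close>.\<close>
        have "t ^ k * (real k / t) = real k * t ^ (k - 1)"
          using t k by (cases k) auto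
        then have e: "ennreal (t ^ k) * ennreal (real k / t) = ennreal (real k * t ^ (k - 1))"
          using t by (simp flip: ennreal_mult)
        have "ennreal (t ^ k) * (G (T t v) * indicator A v * ennreal (real k / t))
            = indicator A v * (G (T t v) * (ennreal (t ^ k) * ennreal (real k / t)))"
          by (simp only: mult_ac)
        then show "ennreal (t ^ k) * (G (T t v) * indicator A v * ennreal (real k / t)) = indicator A v * (G (T t v) * ?w t)"
          unfolding e using t by simp
      qed
      finally show ?thesis .
    qed auto
  qed
  also have "\<dots> = (\<integral>\<^sup>+v. \<integral>\<^sup>+t. indicator A v * (G (T t v) * ?w t) \<partial>lborel \<partial>N)"
    by (rule Fubini'[symmetric]) measurable
  also have "\<dots> \<le> (\<integral>\<^sup>+v. ennreal K * indicator A v \<partial>N)"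
  proof (rule nn_integral_mono)
    fix v
    show "(\<integral>\<^sup>+t. indicator A v * (G (T t v) * ?w t) \<partial>lborel) \<le> ennreal K * indicator A v"
    proof (cases "v \<in> A")
      case True
      then have "v \<in> C" "v \<noteq> v0" using v0A by (auto simp: A_def)
      from line[OF this] show ?thesis using True by (simp add: T_def mult.assoc)
    qed simp
  qed
  also have "\<dots> = ennreal K * ennreal (1 - \<delta> ^ k) * emeasure N C"
    by (subst nn_integral_cmult_indicator) (simp_all add: mass mult.assoc)
  also have "\<dots> \<le> ennreal K * ennreal (real k * ln (1 / \<delta>)) * emeasure N C"
  proof (intro mult_mono ennreal_leI)
    show "1 - \<delta> ^ k \<le> real k * ln (1 / \<delta>)"
      using ln_le_minus_one[of "\<delta> ^ k"] \<delta> by (simp add: ln_realpow ln_div)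
  qed simp_all
  finally have "ennreal (real k * ln (1 / \<delta>)) * ?I \<le> ennreal (real k * ln (1 / \<delta>)) * (ennreal K * emeasure N C)"
    by (simp only: mult_ac)
  moreover have "0 < real k * ln (1 / \<delta>)" using k \<delta> by simp
  ultimately show ?thesis
    unfolding T_def
    by (subst (asm) ennreal_mult_le_mult_iff) (use k in auto)
qed

text \<open>The ratio \<open>\<delta>\<close> tends to 1 along the reciprocals of
  \<open>r n\<close>. By \<open>prolong\<close> every point of \<open>C\<close> lies in one of the
  shrunken copies, which increase, so monotone convergence applies.\<close>

lemma radial_average:
  fixes N :: "'a::euclidean_space measure" and G :: "'a \<Rightarrow> ennreal"
  assumes N: "sigma_finite_measure N" and setsN [measurable_cong]: "sets N = sets borel"
    and hom: "\<And>t g. 0 < t \<Longrightarrow> g \<in> borel_measurable borel \<Longrightarrow>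
      (\<integral>\<^sup>+v. g v \<partial>N) = ennreal (t ^ k) * (\<integral>\<^sup>+v. g (v0 + t *\<^sub>R (v - v0)) \<partial>N)"
    and k: "1 \<le> k" and C: "convex C" "bounded C" "v0 \<in> C" "emeasure N C < \<infinity>"
    and mC [measurable]: "C \<in> sets borel" and mG [measurable]: "G \<in> borel_measurable borel"
    and G0: "G v0 = 0"
    and line: "\<And>v. v \<in> C \<Longrightarrow> v \<noteq> v0 \<Longrightarrow>
      (\<integral>\<^sup>+t. G (v0 + t *\<^sub>R (v - v0)) * ennreal (real k * t ^ (k - 1)) * indicator {0<..<1} t \<partial>lborel) \<le> ennreal K"
    and prolong: "\<And>x. x \<in> C \<Longrightarrow> \<exists>e>1. v0 + e *\<^sub>R (x - v0) \<in> C"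
  shows "(\<integral>\<^sup>+x. G x * indicator C x \<partial>N) \<le> ennreal K * emeasure N C"
proof -
  define r where "r n = 1 + 1 / real (Suc n)" for n
  have r1: "1 < r n" for n by (simp add: r_def)
  define F where "F n x = G x * indicator C (v0 + r n *\<^sub>R (x - v0))" for n x
  have mF: "F n \<in> borel_measurable N" for n unfolding F_def by measurable
  have star: "v0 + s *\<^sub>R (x - v0) \<in> C" if "v0 + t *\<^sub>R (x - v0) \<in> C" "0 \<le> s" "s \<le> t" "0 < t" for s t x
  proof -
    have "v0 + s *\<^sub>R (x - v0) = (1 - s / t) *\<^sub>R v0 + (s / t) *\<^sub>R (v0 + t *\<^sub>R (x - v0))"
      using that by (simp add: algebra_simps)
    then show ?thesis using convexD[OF C(1,3) that(1), of "1 - s / t" "s / t"] that by simp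
  qed
  have inc: "incseq F"
  proof (intro incseq_SucI le_funI)
    fix n x
    have "r (Suc n) \<le> r n" by (simp add: r_def frac_le)
    then show "F n x \<le> F (Suc n) x"
      using star[of "r n" x "r (Suc n)"] r1[of n] r1[of "Suc n"] by (auto simp: F_def indicator_def)
  qed
  have "(\<integral>\<^sup>+x. G x * indicator C x \<partial>N) \<le> (\<integral>\<^sup>+x. (SUP n. F n x) \<partial>N)"
  proof (rule nn_integral_mono)
    fix x
    show "G x * indicator C x \<le> (SUP n. F n x)"
    proof (cases "x \<in> C")
      case True
      from prolong[OF this] obtain e where e: "1 < e" "v0 + e *\<^sub>R (x - v0) \<in> C" by blast
      obtain n where "1 / real (Suc n) < e - 1" using e nat_approx_posE[of "e - 1"] by auto
      then have "r n \<le> e" by (simp add: r_def)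
      then have "v0 + r n *\<^sub>R (x - v0) \<in> C" using star[OF e(2)] r1[of n] e(1) by simp
      then have "G x * indicator C x = F n x" using True by (simp add: F_def)
      then show ?thesis by (metis SUP_upper UNIV_I)
    qed simp
  qed
  also have "\<dots> = (SUP n. \<integral>\<^sup>+x. F n x \<partial>N)"
    by (rule nn_integral_monotone_convergence_SUP[OF inc mF])
  also have "\<dots> \<le> ennreal K * emeasure N C"
  proof (rule SUP_least)
    fix n
    have "(\<integral>\<^sup>+x. G x * indicator C (v0 + (1 / (1 / r n)) *\<^sub>R (x - v0)) \<partial>N) \<le> ennreal K * emeasure N C"
      by (rule radial_average_shell[OF N setsN hom k C mC mG G0 line]) (use r1[of n] in auto)
    then show "(\<integral>\<^sup>+x. F n x \<partial>N) \<le> ennreal K * emeasure N C" by (simp add: F_def)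
  qed
  finally show ?thesis .
qed

text \<open>A homothety of ratio \<open>t < 1\<close> about a relative interior point sends the
  closure into the relative interior. Hence \<open>t ^ k\<close> times the mass of the closure is at
  most the mass of the relative interior, and \<open>t\<close> tends to 1. This will sandwich a
  convex set that need not be Borel.\<close>

lemma closure_diff_rel_interior_null_sets:
  fixes N :: "'a::euclidean_space measure"
  assumes setsN [measurable_cong]: "sets N = sets borel"
    and hom: "\<And>t g. 0 < t \<Longrightarrow> g \<in> borel_measurable borel \<Longrightarrow>
      (\<integral>\<^sup>+v. g v \<partial>N) = ennreal (t ^ k) * (\<integral>\<^sup>+v. g (v0 + t *\<^sub>R (v - v0)) \<partial>N)"
    and k: "1 \<le> k" and V: "convex V" "v0 \<in> rel_interior V"
    and fin: "emeasure N (closure V) < \<infinity>" and mC [measurable]: "rel_interior V \<in> sets borel"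
  shows "closure V - rel_interior V \<in> null_sets N"
proof -
  let ?C = "rel_interior V"
  have mcl [measurable]: "closure V \<in> sets borel" by simp
  have sub: "?C \<subseteq> closure V" using rel_interior_subset closure_subset by blast
  have "emeasure N ?C \<le> emeasure N (closure V)" using sub by (intro emeasure_mono) (simp_all add: setsN)
  then obtain c a where c: "emeasure N ?C = ennreal c" "0 \<le> c"
    and a: "emeasure N (closure V) = ennreal a" "0 \<le> a"
    using fin by (cases "emeasure N ?C"; cases "emeasure N (closure V)") (auto simp: top_unique)
  have "a \<le> c"
  proof (rule field_le_mult_one_interval)
    fix z :: real assume z: "0 < z" "z < 1"
    \<comment> \<open>The root makes the scaling factor \<open>t ^ k\<close> run through all of the
      open unit interval.\<close>
    define t where "t = root k z"
    have t: "0 < t" "t < 1" "t ^ k = z" using z k by (auto simp: t_def)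
    have shrink: "v0 + t *\<^sub>R (v - v0) \<in> ?C" if "v \<in> closure V" for v
      using rel_interior_closure_convex_shrink[OF V that, of "1 - t"] t by (simp add: algebra_simps)
    have "ennreal (z * a) = ennreal z * (\<integral>\<^sup>+v. indicator (closure V) v \<partial>N)"
      using z a(2) by (simp add: a(1) setsN ennreal_mult)
    also have "\<dots> \<le> ennreal z * (\<integral>\<^sup>+v. indicator ?C (v0 + t *\<^sub>R (v - v0)) \<partial>N)"
      by (intro mult_left_mono nn_integral_mono) (auto simp: shrink indicator_def)
    also have "\<dots> = (\<integral>\<^sup>+v. indicator ?C v \<partial>N)"
      using hom[of t "indicator ?C"] t by simp
    also have "\<dots> = ennreal c" using c by (simp add: setsN)
    finally show "z * a \<le> c" using c(2) by simp
  qed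
  have "emeasure N (closure V - ?C) = emeasure N (closure V) - emeasure N ?C"
    using c sub by (intro emeasure_Diff) (auto simp: setsN)
  also have "\<dots> = 0" using a c \<open>a \<le> c\<close> by (simp add: ennreal_minus ennreal_neg)
  finally show ?thesis by (auto simp: null_sets_def setsN)
qed

subsection \<open>Lebesgue measure in an affine subspace\<close>

abbreviation affine_param :: "'a::euclidean_space \<Rightarrow> 'a set \<Rightarrow> ('a \<Rightarrow> real) \<Rightarrow> 'a" where
  "affine_param p B x \<equiv> p + (\<Sum>b\<in>B. x b *\<^sub>R b)"

text \<open>The measure underneath the completion in \<open>affine_lebesgue\<close>; integrals are
  computed on it because Fubini and Borel measurability apply directly.\<close>

abbreviation affine_borel :: "'a::euclidean_space \<Rightarrow> 'a set \<Rightarrow> 'a measure" where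
  "affine_borel p B \<equiv> distr (Pi\<^sub>M B (\<lambda>_. lborel)) borel (affine_param p B)"

lemma measurable_affine_param [measurable]:
  "affine_param p B \<in> borel_measurable (Pi\<^sub>M B (\<lambda>_. lborel))"
  by measurable

lemma nn_integral_affine_borel_homothety:
  fixes g :: "'a::euclidean_space \<Rightarrow> ennreal"
  assumes B: "finite B" and v0: "v0 - p \<in> span B" and t: "0 < t"
    and g [measurable]: "g \<in> borel_measurable borel"
  shows "(\<integral>\<^sup>+v. g v \<partial>affine_borel p B)
    = ennreal (t ^ card B) * (\<integral>\<^sup>+v. g (v0 + t *\<^sub>R (v - v0)) \<partial>affine_borel p B)"
proof -
  obtain a where "v0 - p = (\<Sum>b\<in>B. a b *\<^sub>R b)"
    using v0 span_finite[OF B] by auto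
  then have a: "v0 = p + (\<Sum>b\<in>B. a b *\<^sub>R b)" by (simp add: algebra_simps)
  \<comment> \<open>With \<open>a\<close> the coordinates of \<open>v0\<close>, the homothety about
    \<open>v0\<close> is again a homothety in coordinates, so the product case applies.\<close>
  have "affine_param p B (\<lambda>b\<in>B. (1 - t) * a b + t * x b) = v0 + t *\<^sub>R (affine_param p B x - v0)" for x
    unfolding a by (simp add: algebra_simps sum.distrib scaleR_sum_right sum_subtractf)
  then show ?thesis
    using nn_integral_PiM_lborel_homothety[OF B t, of "\<lambda>x. g (affine_param p B x)" "\<lambda>b. (1 - t) * a b"]
    by (simp add: nn_integral_distr)
qed

text \<open>Coordinates in an orthonormal basis are inner products, so Cauchy-Schwarz confines the
  preimage of \<open>S\<close> to a cube.\<close>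

lemma emeasure_affine_borel_bounded:
  fixes p :: "'a::euclidean_space"
  assumes B: "finite B" "pairwise orthogonal B" "\<And>b. b \<in> B \<Longrightarrow> norm b = 1" and S: "bounded S"
  shows "emeasure (affine_borel p B) S < \<infinity>"
proof (cases "S \<in> sets borel")
  case True
  interpret product_sigma_finite "\<lambda>_::'a. lborel :: real measure" ..
  obtain r where r: "\<And>v. v \<in> S \<Longrightarrow> norm v \<le> r" using S unfolding bounded_iff by blast
  let ?P = "Pi\<^sub>M B (\<lambda>_. lborel :: real measure)"
  let ?Q = "Pi\<^sub>E B (\<lambda>_. {- (r + norm p)..r + norm p})"
  have coord: "\<bar>x b\<bar> \<le> r + norm p" if "affine_param p B x \<in> S" "b \<in> B" for x b
  proof -
    have "(\<Sum>c\<in>B. x c *\<^sub>R c) \<bullet> b = (\<Sum>c\<in>B. x c * (c \<bullet> b))"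
      by (simp add: inner_sum_left)
    also have "\<dots> = (\<Sum>c\<in>B. if c = b then x b else 0)"
    proof (rule sum.cong)
      fix c assume "c \<in> B"
      then show "x c * (c \<bullet> b) = (if c = b then x b else 0)"
        using B(2,3) that(2) by (auto simp: pairwise_def orthogonal_def dot_square_norm)
    qed simp
    also have "\<dots> = x b" using B(1) that(2) by simp
    finally have "x b = (affine_param p B x - p) \<bullet> b" by simp
    then have "\<bar>x b\<bar> \<le> norm (affine_param p B x - p)"
      using Cauchy_Schwarz_ineq2[of "affine_param p B x - p" b] B(3)[OF that(2)] by simp
    also have "\<dots> \<le> norm (affine_param p B x) + norm p" by (rule norm_triangle_ineq4)
    finally show ?thesis using r[OF that(1)] by simp
  qed
  have lower: "- r - norm p \<le> x b" and upper: "x b \<le> r + norm p"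
    if "affine_param p B x \<in> S" "b \<in> B" for x b
    using coord[OF that] by linarith+
  have mQ: "?Q \<in> sets ?P" using B(1) by (intro sets_PiM_I_finite) auto
  have "emeasure (affine_borel p B) S = emeasure ?P (affine_param p B -` S \<inter> space ?P)"
    using emeasure_distr[OF measurable_affine_param, of S B p] True by simp
  also have "\<dots> \<le> emeasure ?P ?Q"
    using mQ lower upper by (intro emeasure_mono) (auto simp: space_PiM PiE_iff)
  also have "\<dots> = (\<Prod>b\<in>B. emeasure lborel {- (r + norm p)..r + norm p})"
    using B(1) by (intro emeasure_PiM) auto
  also have "\<dots> < \<infinity>"
    by (auto simp: less_top[symmetric] ennreal_prod_eq_top emeasure_lborel_Icc_eq simp del: prod_constant)
  finally show ?thesis .
next
  \<comment> \<open>A set that is not Borel has \<open>emeasure\<close> 0 by convention.\<close>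
  case False
  then show ?thesis by (simp add: emeasure_notin_sets)
qed

lemma sigma_finite_affine_borel:
  fixes p :: "'a::euclidean_space"
  assumes "finite B" "pairwise orthogonal B" "\<And>b. b \<in> B \<Longrightarrow> norm b = 1"
  shows "sigma_finite_measure (affine_borel p B)"
proof (rule sigma_finite_measure.intro, intro exI conjI)
  let ?A = "range (\<lambda>n::nat. cball (0::'a) (real n))"
  show "countable ?A" by simp
  show "?A \<subseteq> sets (affine_borel p B)" by auto
  show "\<Union>?A = space (affine_borel p B)" by (auto simp: real_arch_simple)
  show "\<forall>a\<in>?A. emeasure (affine_borel p B) a \<noteq> \<infinity>"
    using emeasure_affine_borel_bounded[OF assms] by (auto simp: less_top)
qed

text \<open>Replaces the two choice operators in \<open>affine_lebesgue\<close> by the properties of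
  their values on which the integration relies.\<close>

lemma affine_lebesgue_cases:
  fixes V :: "'a::euclidean_space set"
  assumes "V \<noteq> {}" "aff_dim V = int k"
  obtains p B where "affine_lebesgue V = completion (affine_borel p B)"
    "finite B" "card B = k" "pairwise orthogonal B" "\<And>b. b \<in> B \<Longrightarrow> norm b = 1"
    "\<And>v. v \<in> V \<Longrightarrow> v - p \<in> span B"
proof -
  let ?D = "span {x - y | x y. x \<in> V \<and> y \<in> V}"
  define p where "p = (SOME p. p \<in> V)"
  have p: "p \<in> V" using assms(1) unfolding p_def by (simp add: some_in_eq)
  define B where "B = (SOME B. orthonormal_basis_of_direction V B)"
  have "\<exists>B. orthonormal_basis_of_direction V B"
    unfolding orthonormal_basis_of_direction_def
    by (rule orthonormal_basis_subspace[OF subspace_span]) blast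
  then have "orthonormal_basis_of_direction V B" unfolding B_def by (rule someI_ex)
  then have B: "pairwise orthogonal B" "\<And>b. b \<in> B \<Longrightarrow> norm b = 1" "span B = ?D"
    by (auto simp: orthonormal_basis_of_direction_def)
  have "0 \<notin> B" using B(2) by force
  then have ind: "independent B" by (rule pairwise_orthogonal_independent[OF B(1)])
  \<comment> \<open>\<open>affine_lebesgue\<close> uses differences of arbitrary pairs, whereas
    \<open>aff_dim\<close> is computed from differences with the fixed point
    \<open>p\<close>.\<close>
  have eq: "?D = span ((+) (- p) ` V)"
  proof (rule span_eq[THEN iffD2], intro conjI subsetI)
    fix z assume "z \<in> {x - y | x y. x \<in> V \<and> y \<in> V}"
    then obtain x y where "x \<in> V" "y \<in> V" "z = (- p + x) - (- p + y)" by auto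
    then show "z \<in> span ((+) (- p) ` V)" by (metis imageI span_base span_diff)
  next
    fix z assume "z \<in> (+) (- p) ` V"
    then obtain v where "v \<in> V" "z = v - p" by auto
    then show "z \<in> ?D" using p by (intro span_base) blast
  qed
  have "int (card B) = int (dim ((+) (- p) ` V))"
    using dim_span_eq_card_independent[OF ind] B(3) eq by simp
  then have "card B = k"
    using aff_dim_eq_dim[of p V] p assms(2) by (simp add: hull_inc)
  moreover have "v - p \<in> span B" if "v \<in> V" for v
    unfolding B(3) using that p by (intro span_base) auto
  ultimately show ?thesis
    using that[of B p] B ind independent_imp_finite[OF ind]
    by (simp add: affine_lebesgue_def Let_def p_def B_def)
qed

subsection \<open>The logarithmic average of a function with a Chebyshev exponent\<close>

text \<open>The larger exponent \<open>d'\<close> avoids dividing by \<open>d = 0\<close>.\<close>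

lemma chebyshev_exponent_sublevel:
  fixes h :: "complex ^ 's \<Rightarrow> complex"
  assumes R: "1 < R" and cont: "continuous_on (ball 0 R) h"
    and d: "chebyshev_exponent h d" "d < d'" "0 < d'"
    and v: "v0 \<in> ball 0 1" "v \<in> ball 0 1" "v \<noteq> v0" and nz: "h v0 \<noteq> 0"
    and A: "A \<subseteq> {t \<in> {0..1}. norm (h (v0 + t *\<^sub>R (v - v0))) < norm (h v0) * exp (- s)}"
  shows "emeasure lborel A \<le> ennreal (4 * exp (- s / d'))"
proof -
  define S where "S = {t \<in> {0..1}. norm (h (v0 + t *\<^sub>R (v - v0))) < norm (h v0) * exp (- s)}"
  \<comment> \<open>The segment is parametrized by arc length because
    \<open>chebyshev_exponent\<close> asks for a unit direction; \<open>\<omega>\<close> is the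
    dilation of \<open>S\<close> by \<open>L\<close>.\<close>
  define L where "L = norm (v - v0)"
  define u where "u = (1 / L) *\<^sub>R (v - v0)"
  have L: "0 < L" using v by (simp add: L_def)
  have u: "norm u = 1" using L by (simp add: u_def L_def)
  define \<omega> where "\<omega> = {\<tau> \<in> {0..L}. norm (h (v0 + \<tau> *\<^sub>R u)) < norm (h v0) * exp (- s)}"
  have seg: "v0 + \<tau> *\<^sub>R u \<in> ball 0 1" if "\<tau> \<in> {0..L}" for \<tau>
  proof -
    have "v0 + \<tau> *\<^sub>R u = (1 - \<tau> / L) *\<^sub>R v0 + (\<tau> / L) *\<^sub>R v"
      using L by (simp add: u_def algebra_simps)
    then show ?thesis using that L convexD[OF convex_ball v(1,2), of "1 - \<tau> / L" "\<tau> / L"] by simp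
  qed
  have sub: "ball 0 1 \<subseteq> ball (0 :: complex ^ 's) R" using R by auto
  have contJ: "continuous_on {0..L} (\<lambda>\<tau>. norm (h (v0 + \<tau> *\<^sub>R u)))"
    by (intro continuous_on_norm continuous_on_compose2[OF cont] continuous_intros)
      (use seg sub in blast)
  \<comment> \<open>Continuity is available on the interval only, so the function is cut off to 0
    outside before measurability is invoked.\<close>
  have mv: "{x \<in> {0..r}. g x < c} \<in> sets borel"
    if "continuous_on {0..r} g" for r c :: real and g :: "real \<Rightarrow> real"
  proof -
    have [measurable]: "(\<lambda>x. indicator {0..r} x *\<^sub>R g x) \<in> borel_measurable borel"
      by (rule borel_measurable_continuous_on_indicator[OF _ that]) simp
    have "{x \<in> {0..r}. g x < c} = {x \<in> space borel. x \<in> {0..r} \<and> indicator {0..r} x *\<^sub>R g x < c}"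
      by auto
    also have "\<dots> \<in> sets borel" by measurable
    finally show ?thesis .
  qed
  have m\<omega>: "\<omega> \<in> sets borel" unfolding \<omega>_def by (rule mv[OF contJ])
  have "\<omega> \<subseteq> {0..L}" by (auto simp: \<omega>_def)
  then have "emeasure lborel \<omega> \<le> emeasure lborel {0..L}" by (intro emeasure_mono) auto
  then have fin: "emeasure lborel \<omega> \<noteq> \<infinity>" using L by (auto simp: top_unique)
  define w where "w = measure lborel \<omega>"
  have w: "emeasure lborel \<omega> = ennreal w" "0 \<le> w"
    using fin by (simp_all add: w_def emeasure_eq_ennreal_measure)
  have scale: "L *\<^sub>R u = v - v0" using L by (simp add: u_def)
  have "v0 + (L * t) *\<^sub>R u = v0 + t *\<^sub>R (v - v0)" for t
    unfolding scale[symmetric] by (simp add: mult.commute)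
  then have S: "S = (\<lambda>t. L * t) -` \<omega>"
    using L by (auto simp: S_def \<omega>_def zero_le_mult_iff)
  have mS: "S \<in> sets borel"
    unfolding S by (rule measurable_sets_borel[OF _ m\<omega>]) simp
  have "ennreal w = (\<integral>\<^sup>+x. indicator \<omega> x \<partial>lborel)" using m\<omega> w by simp
  also have "\<dots> = ennreal \<bar>L\<bar> * (\<integral>\<^sup>+t. indicator \<omega> (0 + L * t) \<partial>lborel)"
    by (rule nn_integral_real_affine) (use m\<omega> L in auto)
  also have "(\<integral>\<^sup>+t. indicator \<omega> (0 + L * t) \<partial>lborel) = (\<integral>\<^sup>+t. indicator S t \<partial>lborel)"
    by (intro nn_integral_cong) (simp add: S indicator_def)
  finally have wS: "ennreal w = ennreal L * emeasure lborel S" using L mS by simp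
  have "w \<le> L * (4 * exp (- s / d'))"
  proof (cases "w = 0")
    case False
    then have w0: "0 < w" using w by simp
    have meas: "measure lebesgue \<omega> = w" using m\<omega> by (simp add: w_def)
    have ne: "\<omega> \<noteq> {}" using w0 by (auto simp: w_def)
    let ?q = "4 * L / w"
    have "w \<le> L"
      using \<open>emeasure lborel \<omega> \<le> emeasure lborel {0..L}\<close> L w by simp
    \<comment> \<open>A base of at least 1 allows the exponent \<open>d\<close> to be raised to
      \<open>d'\<close>.\<close>
    then have q1: "1 \<le> ?q" using w0 L by (simp add: field_simps)
    have bdd: "bdd_above ((\<lambda>\<tau>. norm (h (v0 + \<tau> *\<^sub>R u))) ` {0..L})"
      by (intro bounded_imp_bdd_above compact_imp_bounded compact_continuous_image contJ) simp
    \<comment> \<open>The segment starts at \<open>v0\<close>, so its supremum is at least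
      \<open>norm (h v0)\<close>, while on \<open>\<omega>\<close> the function is smaller by the
      factor \<open>exp (- s)\<close>; the Chebyshev inequality compares the two.\<close>
    have "norm (h v0) \<le> (SUP \<tau>\<in>{0..L}. norm (h (v0 + \<tau> *\<^sub>R u)))"
      using cSUP_upper[OF _ bdd, of 0] L by simp
    also have "\<dots> \<le> (4 * measure lebesgue {0..L} / measure lebesgue \<omega>) powr d
        * (SUP \<tau>\<in>\<omega>. norm (h (v0 + \<tau> *\<^sub>R u)))"
      by (rule d(1)[unfolded chebyshev_exponent_def, rule_format, OF u is_interval_cc])
        (use seg \<open>\<omega> \<subseteq> {0..L}\<close> m\<omega> w0 meas in auto)
    also have "\<dots> = ?q powr d * (SUP \<tau>\<in>\<omega>. norm (h (v0 + \<tau> *\<^sub>R u)))"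
      using L by (simp add: meas)
    also have "\<dots> \<le> ?q powr d' * (norm (h v0) * exp (- s))"
    proof (intro mult_mono)
      show "?q powr d \<le> ?q powr d'" using q1 d by (intro powr_mono) auto
      show "(SUP \<tau>\<in>\<omega>. norm (h (v0 + \<tau> *\<^sub>R u))) \<le> norm (h v0) * exp (- s)"
        using ne by (intro cSUP_least) (auto simp: \<omega>_def)
      obtain \<tau> where "\<tau> \<in> \<omega>" using ne by blast
      moreover have "bdd_above ((\<lambda>\<tau>. norm (h (v0 + \<tau> *\<^sub>R u))) ` \<omega>)"
        using bdd \<open>\<omega> \<subseteq> {0..L}\<close> by (meson bdd_above_mono image_mono)
      ultimately show "0 \<le> (SUP \<tau>\<in>\<omega>. norm (h (v0 + \<tau> *\<^sub>R u)))"
        by (intro cSUP_upper2[of _ _ \<tau>]) auto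
    qed simp
    finally have "exp s \<le> ?q powr d'"
      using nz by (simp add: exp_minus field_simps)
    then have "ln (exp s) \<le> ln (?q powr d')" using q1 by (subst ln_le_cancel_iff) auto
    then have "s \<le> d' * ln ?q" using w0 L by (simp add: ln_powr)
    then have "s / d' \<le> ln ?q" using d(3) by (simp add: field_simps)
    then have "exp (s / d') \<le> exp (ln ?q)" by simp
    then have "exp (s / d') \<le> ?q" using w0 L by simp
    then show ?thesis using w0 by (simp add: exp_minus field_simps)
  qed (use L in simp)
  then have "ennreal L * emeasure lborel S \<le> ennreal L * ennreal (4 * exp (- s / d'))"
    using L by (simp add: ennreal_mult[symmetric] flip: wS)
  then have "emeasure lborel S \<le> ennreal (4 * exp (- s / d'))"
    using L by (subst (asm) ennreal_mult_le_mult_iff) auto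
  moreover have "emeasure lborel A \<le> emeasure lborel S"
    using A mS by (intro emeasure_mono) (simp_all add: S_def)
  ultimately show ?thesis by simp
qed

text \<open>Negative values of the logarithm are truncated to \<open>0\<close> by \<open>ennreal\<close>.\<close>

definition log_deficit :: "real \<Rightarrow> ('a \<Rightarrow> complex) \<Rightarrow> 'a \<Rightarrow> ennreal" where
  "log_deficit m h v = (if h v = 0 then \<infinity> else ennreal (ln (m / norm (h v))))"

text \<open>Outside \<open>S\<close> the function \<open>h\<close> is arbitrary; replacing it by its
  cut-off leaves the product unchanged.\<close>

lemma measurable_log_deficit_indicator:
  fixes h :: "'a::euclidean_space \<Rightarrow> complex"
  assumes "continuous_on S h" and [measurable]: "S \<in> sets borel"
  shows "(\<lambda>v. log_deficit m h v * indicator S v) \<in> borel_measurable borel"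
proof -
  have [measurable]: "(\<lambda>v. indicator S v *\<^sub>R h v) \<in> borel_measurable borel"
    by (rule borel_measurable_continuous_on_indicator) (use assms in auto)
  have "(\<lambda>v. log_deficit m h v * indicator S v) = (\<lambda>v. log_deficit m (\<lambda>v. indicator S v *\<^sub>R h v) v * indicator S v)"
    by (simp add: log_deficit_def indicator_def fun_eq_iff)
  also have "\<dots> \<in> borel_measurable borel"
    unfolding log_deficit_def by measurable
  finally show ?thesis .
qed

text \<open>Turns the superlevel sets of the layer-cake formula into the sublevel sets of the
  Chebyshev estimate; zeros of \<open>h\<close>, where the deficit is infinite, belong to all of
  them.\<close>

lemma less_log_deficit:
  assumes "0 \<le> s" "0 < m" "ennreal s < log_deficit m h v"
  shows "norm (h v) < m * exp (- s)"
proof (cases "h v = 0")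
  case False
  then have "s < ln (m / norm (h v))"
    using assms by (simp add: log_deficit_def ennreal_less_iff)
  then have "exp s < exp (ln (m / norm (h v)))" by simp
  then have "exp s < m / norm (h v)" using False assms by simp
  then show ?thesis using False by (simp add: exp_minus field_simps)
qed (use assms in simp)

text \<open>The radial density has total mass 1 and is at most \<open>k\<close>, so the sublevel
  estimate yields an exponential tail with constant \<open>4 * real k\<close>. The additional
  summand \<open>d'\<close> of the tail integral is absorbed as the factor \<open>exp 1\<close>
  inside the logarithm.\<close>

lemma log_deficit_line_integral:
  fixes h :: "complex ^ 's \<Rightarrow> complex"
  assumes R: "1 < R" and cont: "continuous_on (ball 0 R) h"
    and d: "chebyshev_exponent h d" "d < d'" "0 < d'" and k: "1 \<le> k"
    and v: "v0 \<in> ball 0 1" "v \<in> ball 0 1" "v \<noteq> v0" and nz: "h v0 \<noteq> 0"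
  shows "(\<integral>\<^sup>+t. log_deficit (norm (h v0)) h (v0 + t *\<^sub>R (v - v0)) * indicator (ball 0 1) (v0 + t *\<^sub>R (v - v0))
      * ennreal (real k * t ^ (k - 1)) * indicator {0<..<1} t \<partial>lborel)
    \<le> ennreal (d' * ln (4 * exp 1 * real k))"
proof -
  define G where "G x = log_deficit (norm (h v0)) h x * indicator (ball 0 1) x" for x
  define w :: "real \<Rightarrow> ennreal" where "w t = ennreal (real k * t ^ (k - 1)) * indicator {0<..<1} t" for t
  have w [measurable]: "w \<in> borel_measurable borel" unfolding w_def by measurable
  have [measurable]: "G \<in> borel_measurable borel"
    unfolding G_def using R by (intro measurable_log_deficit_indicator continuous_on_subset[OF cont]) auto
  define u where "u t = G (v0 + t *\<^sub>R (v - v0))" for t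
  have [measurable]: "u \<in> borel_measurable borel" unfolding u_def by measurable
  let ?N = "density lborel w"
  have "(\<integral>\<^sup>+t. u t \<partial>?N) \<le> ennreal (d' * ln (4 * real k) + d')"
  proof (rule nn_integral_le_of_exponential_tail)
    have "emeasure ?N (space ?N) = (\<integral>\<^sup>+t. w t \<partial>lborel)" by (simp add: emeasure_density)
    also have "\<dots> \<le> (\<integral>\<^sup>+t. ennreal (real k * t ^ (k - 1)) * indicator {0..1} t \<partial>lborel)"
      by (intro nn_integral_mono) (auto simp: w_def indicator_def)
    also have "\<dots> = ennreal (1 ^ k - 0 ^ k)"
      by (rule nn_integral_FTC_Icc) (auto intro!: derivative_eq_intros)
    finally show "emeasure ?N (space ?N) \<le> 1" using k by (simp add: zero_power)
    fix s :: real assume s: "0 \<le> s"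
    let ?S = "{t \<in> {0..1}. norm (h (v0 + t *\<^sub>R (v - v0))) < norm (h v0) * exp (- s)}"
    let ?A = "{t \<in> space lborel. ennreal s < u t \<and> t \<in> {0<..<1}}"
    have "?A \<subseteq> ?S"
    proof
      fix t assume t: "t \<in> ?A"
      then have "ennreal s < log_deficit (norm (h v0)) h (v0 + t *\<^sub>R (v - v0))"
        by (cases "v0 + t *\<^sub>R (v - v0) \<in> ball 0 1") (simp_all add: u_def G_def)
      with less_log_deficit[OF s _ this] t nz show "t \<in> ?S" by simp
    qed
    have "emeasure ?N {t \<in> space ?N. ennreal s < u t} = (\<integral>\<^sup>+t. w t * indicator {t \<in> space lborel. ennreal s < u t} t \<partial>lborel)"
      by (subst emeasure_density) auto
    also have "\<dots> \<le> (\<integral>\<^sup>+t. ennreal (real k) * indicator ?A t \<partial>lborel)"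
    proof (rule nn_integral_mono)
      fix t :: real
      show "w t * indicator {t \<in> space lborel. ennreal s < u t} t \<le> ennreal (real k) * indicator ?A t"
      proof (cases "t \<in> ?A")
        case True
        then have "real k * t ^ (k - 1) \<le> real k" by (simp add: mult_left_le power_le_one)
          from ennreal_leI[OF this] show ?thesis using True by (simp add: w_def)
      qed (auto simp: w_def indicator_def)
    qed
    also have "\<dots> = ennreal (real k) * emeasure lborel ?A"
      by (rule nn_integral_cmult_indicator) measurable
    also have "\<dots> \<le> ennreal (real k) * ennreal (4 * exp (- s / d'))"
      by (intro mult_left_mono chebyshev_exponent_sublevel[OF R cont d v nz \<open>?A \<subseteq> ?S\<close>]) simp
    also have "\<dots> = ennreal (4 * real k * exp (- s / d'))"
      by (simp add: ennreal_mult[symmetric] mult_ac)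
    finally show "emeasure ?N {t \<in> space ?N. ennreal s < u t} \<le> ennreal (4 * real k * exp (- s / d'))" .
  qed (use d k in auto)
  moreover have "d' * ln (4 * real k) + d' = d' * ln (4 * exp 1 * real k)"
    using k by (simp add: ln_mult algebra_simps)
  moreover have "(\<integral>\<^sup>+t. u t \<partial>?N) = (\<integral>\<^sup>+t. u t * ennreal (real k * t ^ (k - 1)) * indicator {0<..<1} t \<partial>lborel)"
    by (simp add: nn_integral_density w_def mult_ac)
  ultimately show ?thesis by (simp add: u_def G_def)
qed

subsection \<open>The zero count\<close>

text \<open>Jensen's bound is split at the level \<open>m\<close>; where the value at 0 exceeds
  \<open>m\<close>, truncating the negative logarithm only enlarges the bound. If
  \<open>f v 0 = 0\<close> the right side is infinite, which also covers an identically vanishing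
  member of the family.\<close>

lemma zero_count_le_log_deficit:
  fixes f :: "complex ^ 's \<Rightarrow> complex \<Rightarrow> complex"
  assumes hol: "f v holomorphic_on ball 0 1" and bound: "\<And>z. norm z < 1 \<Longrightarrow> norm (f v z) \<le> M"
    and m: "0 < m" "m \<le> M" and \<rho>: "0 < \<rho>" "\<rho> < 1"
  shows "zero_count f \<rho> v \<le> ennreal (1 / ln (1 / \<rho>)) * (ennreal (ln (M / m)) + log_deficit m (\<lambda>v. f v 0) v)"
proof (cases "f v 0 = 0")
  case True
  then show ?thesis using \<rho> by (simp add: log_deficit_def ennreal_mult_top)
next
  case False
  let ?n = "card {z \<in> cball 0 \<rho>. f v z = 0}" and ?a = "norm (f v 0)"
  have lam: "0 < ln (1 / \<rho>)" using \<rho> by simp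
  have lm: "0 \<le> ln (M / m)" using m by simp
  have "real ?n * ln (1 / \<rho>) \<le> ln (M / ?a)"
    by (rule card_zeros_mult_ln_le[OF hol bound False \<rho>])
  also have "\<dots> = ln (M / m) + ln (m / ?a)" using m False by (simp add: ln_div)
  finally have "real ?n * ln (1 / \<rho>) \<le> ln (M / m) + max 0 (ln (m / ?a))" by simp
  then have "real ?n \<le> 1 / ln (1 / \<rho>) * (ln (M / m) + max 0 (ln (m / ?a)))"
    using lam by (simp add: field_simps)
  then have "ennreal (real ?n) \<le> ennreal (1 / ln (1 / \<rho>) * (ln (M / m) + max 0 (ln (m / ?a))))"
    by (rule ennreal_leI)
  also have "\<dots> = ennreal (1 / ln (1 / \<rho>)) * (ennreal (ln (M / m)) + ennreal (max 0 (ln (m / ?a))))"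
    using lam lm
    by (simp add: ennreal_mult[symmetric] ennreal_plus[symmetric] del: ennreal_plus)
  also have "ennreal (max 0 (ln (m / ?a))) = log_deficit m (\<lambda>v. f v 0) v"
    using False by (simp add: log_deficit_def max_def ennreal_neg)
  finally show ?thesis
    using False by (auto simp: zero_count_def ennreal_of_nat_eq_real_of_nat)
qed

section \<open>Regularity in each variable separately, and the relative interior\<close>

lemma holomorphic_family_on_fiber:
  assumes "holomorphic_family_on f (S \<times> T)" "v \<in> S"
  shows "f v holomorphic_on T"
  unfolding holomorphic_on_def
proof
  fix z assume "z \<in> T"
  then obtain D where D: "((\<lambda>(v, z). f v z) has_derivative D) (at (v, z))"
    "\<And>c w \<zeta>. D (c *s w, c * \<zeta>) = c * D (w, \<zeta>)"
    using assms unfolding holomorphic_family_on_def by blast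
  have "((\<lambda>z. (v, z)) has_derivative (\<lambda>\<zeta>. (0, \<zeta>))) (at z)"
    by (auto intro!: derivative_eq_intros)
  from has_derivative_compose[OF this D(1)]
  have "(f v has_derivative (\<lambda>\<zeta>. D (0, \<zeta>))) (at z)" by simp
  moreover define c where "c = D (0, 1)"
  \<comment> \<open>Complex homogeneity of \<open>D\<close> along the second axis turns the real
    derivative into a complex one.\<close>
  have "D (0, \<zeta>) = c * \<zeta>" for \<zeta>
    using D(2)[of \<zeta> 0 1] by (simp add: c_def mult.commute)
  ultimately have "(f v has_field_derivative c) (at z)"
    by (simp add: has_field_derivative_def)
  then show "f v field_differentiable at z within T"
    using field_differentiable_at_within field_differentiable_def by blast
qed

lemma holomorphic_family_on_imp_continuous_on:
  assumes "holomorphic_family_on f (S \<times> T)" "z \<in> T"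
  shows "continuous_on S (\<lambda>v. f v z)"
proof -
  have "continuous_on (S \<times> T) (\<lambda>(v, z). f v z)"
    unfolding continuous_on_eq_continuous_within
    using assms(1) has_derivative_continuous continuous_at_imp_continuous_at_within
    unfolding holomorphic_family_on_def by blast
  moreover have "continuous_on S (\<lambda>v. (v, z))" by (intro continuous_intros)
  ultimately have "continuous_on S (\<lambda>v. case (v, z) of (v, z) \<Rightarrow> f v z)"
    by (rule continuous_on_compose2) (use assms(2) in auto)
  then show ?thesis by simp
qed

lemma rel_interior_in_borel:
  fixes V :: "'a::euclidean_space set"
  shows "rel_interior V \<in> sets borel"
proof -
  obtain U where "open U" "rel_interior V = affine hull V \<inter> U"
    using openin_rel_interior[of V] by (auto simp: openin_open)
  then show ?thesis by (simp add: closed_affine_hull)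
qed

text \<open>The slack \<open>e\<close> enters twice: it makes the exponent \<open>d + e\<close>
  positive, and it pays for a centre \<open>v0\<close> at which the supremum is only nearly
  attained.\<close>

lemma zero_count_average:
  fixes f :: "complex ^ 's \<Rightarrow> complex \<Rightarrow> complex" and V :: "(complex ^ 's) set"
  assumes R: "1 < R" and hol: "holomorphic_family_on f (ball 0 R \<times> ball 0 1)"
    and V: "V \<subseteq> ball 0 1" "convex V" "aff_dim V = int k" "1 \<le> k"
    and bound: "\<And>v z. v \<in> V \<Longrightarrow> norm z < 1 \<Longrightarrow> norm (f v z) \<le> M1"
    and M2: "0 < M2" "ereal M2 \<le> (SUP v\<in>V. ereal (norm (f v 0)))"
    and \<rho>: "0 < \<rho>" "\<rho> < 1"
    and d: "0 \<le> d" "chebyshev_exponent (\<lambda>v. f v 0) d" and e: "0 < e"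
  defines "q \<equiv> ((d + e) * ln (4 * exp 1 * real k) + (ln (M1 / M2) + e)) / ln (1 / \<rho>)"
  shows "0 \<le> q" and "(1 / emeasure (affine_lebesgue V) V)
      * (\<integral>\<^sup>+v\<in>V. zero_count f \<rho> v \<partial>affine_lebesgue V) \<le> ennreal q"
proof -
  have V0: "V \<noteq> {}" using V(3) by auto
  from affine_lebesgue_cases[OF V0 V(3)] obtain p B where
    pB: "affine_lebesgue V = completion (affine_borel p B)"
    and B: "finite B" "card B = k" "pairwise orthogonal B" "\<And>b. b \<in> B \<Longrightarrow> norm b = 1"
      "\<And>v. v \<in> V \<Longrightarrow> v - p \<in> span B" by blast
  define N where "N = affine_borel p B"
  have setsN [measurable_cong]: "sets N = sets borel" by (simp add: N_def)
  have spN: "space N = UNIV" by (simp add: N_def)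
  define C where "C = rel_interior V"
  have CV: "C \<subseteq> V" unfolding C_def by (rule rel_interior_subset)
  have mC [measurable]: "C \<in> sets borel" unfolding C_def by (rule rel_interior_in_borel)
  have bV: "bounded V" using V(1) bounded_ball bounded_subset by blast
  have fin: "emeasure N S < \<infinity>" if "bounded S" for S
    unfolding N_def by (rule emeasure_affine_borel_bounded) (use B that in auto)
  let ?h = "\<lambda>v. f v 0"
  have cont: "continuous_on (ball 0 R) ?h"
    by (rule holomorphic_family_on_imp_continuous_on[OF hol]) simp
  \<comment> \<open>Being nearly maximal is an open condition and the relative interior is dense in
    \<open>V\<close>, so the centre can be moved into the relative interior, as the averaging over
    rays demands.\<close>
  obtain v0 where v0: "v0 \<in> C" "M2 * exp (- e) < norm (f v0 0)"
  proof -
    have "M2 * exp (- e) < M2 * 1" using M2 e by (intro mult_strict_left_mono) auto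
    then have "ereal (M2 * exp (- e)) < (SUP v\<in>V. ereal (norm (f v 0)))"
      using M2(2) by (intro less_le_trans[OF _ M2(2)]) simp
    then obtain v where v: "v \<in> V" "M2 * exp (- e) < norm (f v 0)"
      by (auto simp: less_SUP_iff)
    let ?U = "ball 0 R \<inter> (\<lambda>v. norm (f v 0)) -` {M2 * exp (- e)<..}"
    have "open ?U"
      by (intro continuous_open_preimage continuous_on_norm cont) auto
    moreover have "v \<in> ?U" using v V(1) R by auto
    moreover have "v \<in> closure C"
      unfolding C_def convex_closure_rel_interior[OF V(2)] using v closure_subset by auto
    ultimately have "?U \<inter> C \<noteq> {}" using open_Int_closure_eq_empty by blast
    then show ?thesis using that by auto
  qed
  define m where "m = norm (f v0 0)"
  have m: "0 < m" "M2 * exp (- e) < m"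
    using v0(2) less_trans[OF _ v0(2), of 0] M2 by (simp_all add: m_def)
  have nz: "f v0 0 \<noteq> 0" using m by (auto simp: m_def)
  have v0V: "v0 \<in> V" using v0 CV by auto
  have mM: "m \<le> M1" unfolding m_def by (rule bound) (use v0V in auto)
  define L where "L = ln (4 * exp 1 * real k)"
  have L: "0 \<le> L"
  proof -
    have "1 \<le> 4 * exp (1::real)" using one_le_exp_iff[of "1::real"] by linarith
    then have "1 * 1 \<le> (4 * exp 1) * real k" using V(4) by (intro mult_mono) auto
    then show ?thesis by (simp add: L_def)
  qed
  define K where "K = (d + e) * L"
  have K: "0 \<le> K" using d e L by (simp add: K_def)
  have lam: "0 < ln (1 / \<rho>)" using \<rho> by simp
  define l where "l = ln (M1 / m)"
  have l: "0 \<le> l" using m mM by (simp add: l_def)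
  have l_le: "l \<le> ln (M1 / M2) + e"
  proof -
    have "ln (M2 * exp (- e)) < ln m" using m M2 by (subst ln_less_cancel_iff) auto
    then show ?thesis using m mM M2 by (simp add: l_def ln_div ln_mult)
  qed
  have Kl: "(K + l) / ln (1 / \<rho>) \<le> q"
    unfolding q_def K_def L_def[symmetric] using l_le lam by (intro divide_right_mono) auto
  have "0 \<le> (K + l) / ln (1 / \<rho>)" using K l lam by simp
  \<comment> \<open>Since \<open>ennreal\<close> truncates negative reals to 0, this sign is what
    lets the bound by \<open>ennreal q\<close> be read as a real inequality.\<close>
  with Kl show q: "0 \<le> q" by linarith
  have hom: "(\<integral>\<^sup>+v. g v \<partial>N) = ennreal (t ^ k) * (\<integral>\<^sup>+v. g (v0 + t *\<^sub>R (v - v0)) \<partial>N)"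
    if "0 < t" "g \<in> borel_measurable borel" for t g
    unfolding N_def B(2)[symmetric]
    by (rule nn_integral_affine_borel_homothety) (use B v0V that in auto)
  define G where "G v = log_deficit m ?h v * indicator (ball 0 1) v" for v
  have mG [measurable]: "G \<in> borel_measurable borel"
    unfolding G_def using R by (intro measurable_log_deficit_indicator continuous_on_subset[OF cont]) auto
  have avg: "(\<integral>\<^sup>+v. G v * indicator C v \<partial>N) \<le> ennreal K * emeasure N C"
  proof (rule radial_average[OF _ setsN hom V(4) _ _ v0(1) _ mC mG])
    show "sigma_finite_measure N"
      unfolding N_def by (rule sigma_finite_affine_borel) (use B in auto)
    show "convex C" unfolding C_def using V(2) by (rule convex_rel_interior)
    show "bounded C" using bV CV by (rule bounded_subset)
    then show "emeasure N C < \<infinity>" by (rule fin)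
    show "G v0 = 0" using nz by (simp add: G_def log_deficit_def m_def)
  next
    fix v assume v: "v \<in> C" "v \<noteq> v0"
    show "(\<integral>\<^sup>+t. G (v0 + t *\<^sub>R (v - v0)) * ennreal (real k * t ^ (k - 1)) * indicator {0<..<1} t \<partial>lborel) \<le> ennreal K"
      unfolding G_def m_def K_def L_def
      by (rule log_deficit_line_integral[OF R cont d(2)]) (use d e V v v0V CV nz in auto)
  next
    fix x assume "x \<in> C"
    then obtain r where r: "1 < r" "(1 - r) *\<^sub>R v0 + r *\<^sub>R x \<in> C"
      using convex_rel_interior_iff[OF convex_rel_interior[OF V(2)], of x] v0(1) V(2)
      by (auto simp: C_def rel_interior_rel_interior)
    then have "v0 + r *\<^sub>R (x - v0) \<in> C" by (simp add: algebra_simps)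
    with r show "\<exists>r>1. v0 + r *\<^sub>R (x - v0) \<in> C" by blast
  qed
  \<comment> \<open>\<open>V\<close> itself may fail to be Borel, but it differs from
    \<open>C\<close> by a subset of a Borel null set and so is measurable for the
    completion.\<close>
  have null: "V - C \<in> null_sets (completion N)"
  proof (rule null_sets_completion_subset)
    show "V - C \<subseteq> closure V - C" using closure_subset by blast
    have "closure V - C \<in> null_sets N"
      unfolding C_def
      by (rule closure_diff_rel_interior_null_sets[OF setsN hom V(4,2)])
        (use v0 fin bV bounded_closure mC in \<open>auto simp: C_def\<close>)
    then show "closure V - C \<in> null_sets (completion N)" by (rule null_sets_completionI)
  qed
  have VC: "V = C \<union> (V - C)" using CV by blast
  have massV: "emeasure (completion N) V = emeasure N C"
    by (subst VC, subst emeasure_Un_null_set[OF _ null]) (use mC setsN in auto)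
  let ?c = "ennreal (1 / ln (1 / \<rho>))"
  \<comment> \<open>The comparison holds off the null set \<open>V - C\<close>; the majorant is
    Borel, so its integrals for \<open>N\<close> and for the completion agree.\<close>
  have "(\<integral>\<^sup>+v\<in>V. zero_count f \<rho> v \<partial>completion N)
      \<le> (\<integral>\<^sup>+v. ?c * (ennreal l * indicator C v + G v * indicator C v) \<partial>completion N)"
  proof (rule nn_integral_mono_AE)
    have "AE v in completion N. v \<notin> V - C" using null by (rule AE_not_in)
    then show "AE v in completion N. zero_count f \<rho> v * indicator V v
        \<le> ?c * (ennreal l * indicator C v + G v * indicator C v)"
    proof eventually_elim
      case (elim v)
      show ?case
      proof (cases "v \<in> V")
        case True
        then have "v \<in> C" using elim by auto
        have "zero_count f \<rho> v \<le> ?c * (ennreal (ln (M1 / m)) + log_deficit m ?h v)"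
        proof (rule zero_count_le_log_deficit[OF _ _ m(1) mM \<rho>])
          show "f v holomorphic_on ball 0 1"
            by (rule holomorphic_family_on_fiber[OF hol]) (use True V(1) R in auto)
        qed (use bound True in auto)
        moreover have "v \<in> ball 0 1" using True V(1) by blast
        ultimately show ?thesis using \<open>v \<in> C\<close> True by (simp add: G_def l_def)
      qed simp
    qed
  qed
  also have "\<dots> = ?c * (ennreal l * emeasure N C + (\<integral>\<^sup>+v. G v * indicator C v \<partial>N))"
    by (simp add: nn_integral_completion nn_integral_cmult nn_integral_add setsN)
  also have "\<dots> \<le> ?c * (ennreal l * emeasure N C + ennreal K * emeasure N C)"
    by (intro mult_left_mono add_left_mono avg) auto
  also have "\<dots> = ?c * (ennreal K + ennreal l) * emeasure N C"
    by (simp add: algebra_simps)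
  also have "?c * (ennreal K + ennreal l) = ennreal ((K + l) / ln (1 / \<rho>))"
    using K l lam by (simp add: ennreal_mult[symmetric] ennreal_plus[symmetric] del: ennreal_plus)
  also have "\<dots> * emeasure N C \<le> ennreal q * emeasure N C"
    using Kl by (intro mult_right_mono ennreal_leI) auto
  finally have main: "(\<integral>\<^sup>+v\<in>V. zero_count f \<rho> v \<partial>completion N) \<le> ennreal q * emeasure N C" .
  have finC: "emeasure N C < \<infinity>" by (rule fin[OF bounded_subset[OF bV CV]])
  have "(1 / emeasure N C) * (\<integral>\<^sup>+v\<in>V. zero_count f \<rho> v \<partial>completion N)
      \<le> (1 / emeasure N C) * (ennreal q * emeasure N C)"
    by (intro mult_left_mono main) simp
  also have "\<dots> \<le> ennreal q"
  \<comment> \<open>Zero volume is harmless: the prefactor becomes infinite, but infinity times 0 is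
    0 in \<open>ennreal\<close>.\<close>
  proof (cases "emeasure N C = 0")
    case False
    have "(1 / emeasure N C) * (ennreal q * emeasure N C) = ennreal q * (emeasure N C / emeasure N C)"
      by (simp add: divide_ennreal_def mult_ac)
    then show ?thesis using False finC by simp
  qed simp
  finally show "(1 / emeasure (affine_lebesgue V) V)
      * (\<integral>\<^sup>+v\<in>V. zero_count f \<rho> v \<partial>affine_lebesgue V) \<le> ennreal q"
    unfolding pB N_def[symmetric] massV .
qed

section \<open>Passage from admissible exponents to the Chebyshev degree\<close>

theorem corollary1p6:
  fixes f :: "complex ^ 's \<Rightarrow> complex \<Rightarrow> complex"
    and V :: "(complex ^ 's) set"
    and R M1 M2 \<rho> :: real and k :: nat
  assumes "1 < R"
    and "holomorphic_family_on f (ball 0 R \<times> ball 0 1)"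
    and "V \<subseteq> ball 0 1"
    and "convex V"
    and "aff_dim V = int k"
    and "1 \<le> k"
    and "(SUP v\<in>V. SUP z\<in>ball 0 1. ereal (norm (f v z))) \<le> ereal M1"
    and "0 < M2"
    and "ereal M2 \<le> (SUP v\<in>V. ereal (norm (f v 0)))"
    and "0 < \<rho>" and "\<rho> < 1"
  shows "enn2ereal ((1 / emeasure (affine_lebesgue V) V)
             * (\<integral>\<^sup>+v\<in>V. zero_count f \<rho> v \<partial>affine_lebesgue V))
          \<le> (chebyshev_degree (\<lambda>v. f v 0) * ereal (ln (4 * exp 1 * real k)) + ereal (ln (M1 / M2)))
              / ereal (ln (1 / \<rho>))"
proof -
  define X where "X = (1 / emeasure (affine_lebesgue V) V) * (\<integral>\<^sup>+v\<in>V. zero_count f \<rho> v \<partial>affine_lebesgue V)"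
  define L where "L = ln (4 * exp 1 * real k)"
  define l where "l = ln (M1 / M2)"
  define lam where "lam = ln (1 / \<rho>)"
  define D where "D = {d. 0 \<le> d \<and> chebyshev_exponent (\<lambda>v. f v 0) d}"
  have lam: "0 < lam" using assms(10,11) by (simp add: lam_def)
  have L: "0 < L"
  proof -
    have "1 < 4 * exp (1::real)" using one_le_exp_iff[of "1::real"] by linarith
    then have "1 * 1 < (4 * exp 1) * real k" using assms(6) by (intro mult_less_le_imp_less) auto
    then show ?thesis unfolding L_def by (intro ln_gt_zero) linarith
  qed
  have bound: "norm (f v z) \<le> M1" if "v \<in> V" "norm z < 1" for v z
  proof -
    have "ereal (norm (f v z)) \<le> (SUP z\<in>ball 0 1. ereal (norm (f v z)))"
      by (rule SUP_upper) (use that in auto)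
    also have "\<dots> \<le> (SUP v\<in>V. SUP z\<in>ball 0 1. ereal (norm (f v z)))"
      by (rule SUP_upper) (rule that)
    also have "\<dots> \<le> ereal M1" by fact
    finally show ?thesis by simp
  qed
  have deg: "chebyshev_degree (\<lambda>v. f v 0) = (INF d\<in>D. ereal d)"
    by (simp add: chebyshev_degree_def D_def)
  have avg: "0 \<le> ((d + e) * L + (l + e)) / lam" "X \<le> ennreal (((d + e) * L + (l + e)) / lam)"
    if "d \<in> D" "0 < e" for d e
    using zero_count_average[OF assms(1-6) bound assms(8-11)] that
    unfolding D_def L_def l_def lam_def X_def by auto
  have "enn2ereal X \<le> ((INF d\<in>D. ereal d) * ereal L + ereal l) / ereal lam"
  \<comment> \<open>The infimum over the empty set is infinity; since \<open>L\<close> and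
    \<open>lam\<close> are positive, so is the whole right side.\<close>
  proof (cases "D = {}")
    case True
    then show ?thesis using L lam by (simp add: top_ereal_def)
  next
    case False
    then obtain d0 where d0: "d0 \<in> D" by blast
    from avg(2)[OF d0, of 1] obtain x where x: "X = ennreal x" "0 \<le> x"
      by (cases X) (auto simp: top_unique)
    \<comment> \<open>The inequality is solved for \<open>d\<close>, giving a lower bound common to
      all admissible exponents and thus valid for their infimum.\<close>
    have le: "(x * lam - l) / L \<le> d" if "d \<in> D" for d
    proof -
      have "x * lam \<le> d * L + l"
      proof (rule field_le_epsilon)
        fix e :: real assume "0 < e"
        \<comment> \<open>The exponent contributes slack \<open>e' * L\<close> and the logarithm
          contributes \<open>e'\<close>; together they equal \<open>e\<close>.\<close>
        define e' where "e' = e / (L + 1)"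
        have e': "0 < e'" using \<open>0 < e\<close> L by (simp add: e'_def)
        have e'L: "e' * (L + 1) = e" using L by (simp add: e'_def)
        have "x \<le> ((d + e') * L + (l + e')) / lam"
          using avg[OF that e'] x by simp
        then have "x * lam \<le> d * L + l + e' * (L + 1)"
          using lam by (simp add: pos_le_divide_eq algebra_simps)
        then show "x * lam \<le> d * L + l + e" by (simp only: e'L)
      qed
      then show ?thesis using L by (simp add: pos_divide_le_eq)
    qed
    have lower: "ereal ((x * lam - l) / L) \<le> (INF d\<in>D. ereal d)"
      by (rule INF_greatest) (use le in simp)
    \<comment> \<open>Enclosed between two reals, the infimum is finite, and the extended real
      expression becomes a real one.\<close>
    have "(INF d\<in>D. ereal d) \<le> ereal d0" by (rule INF_lower[OF d0])
    with lower obtain c where c: "(INF d\<in>D. ereal d) = ereal c"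
      by (cases "INF d\<in>D. ereal d") auto
    then have "(x * lam - l) / L \<le> c" using lower by simp
    then have "x \<le> (c * L + l) / lam" using L lam by (simp add: field_simps)
    then show ?thesis using x lam by (simp add: c)
  qed
  then show ?thesis unfolding X_def L_def l_def lam_def deg .
qed

end
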